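(* Let $K\subset\overline{\mathbb{C}_-}$ be a compact set with connected complement $\mathbb{C}\setminus K$, let $f\in D_a(\mathbb{C}_+)$, $g\in A(K)$, $\sigma>0$ and $\varepsilon>0$. Then there exists a Dirichlet polynomial $h=\sum_{n=1}^N a_n n^{-s}$ such that $\|h-g\|_{C(K)}<\varepsilon$ and $\|h-f\|_\sigma<\varepsilon$.
   Context: $\mathbb{C}_+=\{s\in\mathbb{C}:\operatorname{Re} s>0\}$, $\mathbb{C}_-=\{s\in\mathbb{C}:\operatorname{Re} s<0\}$, so $\overline{\mathbb{C}_-}=\{s\in\mathbb{C}:\operatorname{Re} s\le 0\}$. For $\sigma>0$ and a Dirichlet series, $\left\|\sum_{n=1}^{\infty}a_n n^{-s}\right\|_\sigma=\sum_{n=1}^{\infty}|a_n|n^{-\sigma}$. $D_a(\mathbb{C}_+)$ is the space of Dirichlet series $\sum_{n=1}^{\infty}a_n n^{-s}$ ($a_n\in\mathbb{C}$) with $\left\|\sum_{n=1}^{\infty}a_n n^{-s}\right\|_\sigma<\infty$ for all $\sigma>0$. For compact $K\subset\mathbb{C}$, $A(K)$ is the set of functions $K\to\mathbb{C}$ that are continuous on $K$ and holomorphic on the interior of $K$, and $\|\cdot\|_{C(K)}$ is the supremum norm on $K$. A Dirichlet polynomial is a finite sum $\sum_{n=1}^N a_n n^{-s}$ with $a_n\in\mathbb{C}$. *)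

theory Defs
  imports "HOL-Analysis.Analysis"
begin

text \<open>
  A Dirichlet series \<open>\<Sum>n\<ge>1. a n * n powr (-s)\<close> is given by its coefficient sequence
  \<open>a :: nat \<Rightarrow> complex\<close>; the value \<open>a 0\<close> is irrelevant and never used.
  Norms take values in \<^typ>\<open>ennreal\<close>, so that divergent series have norm \<open>\<infinity>\<close> and the supremum
  over the empty set is \<open>0\<close>, whereas \<open>suminf\<close> and \<open>Sup\<close> on \<^typ>\<open>real\<close> would be unspecified there.
\<close>

definition dirichlet_norm :: "real \<Rightarrow> (nat \<Rightarrow> complex) \<Rightarrow> ennreal" where
  "dirichlet_norm \<sigma> a = (\<Sum>n. ennreal (norm (a (Suc n)) * real (Suc n) powr (- \<sigma>)))"

definition Da_space :: "(nat \<Rightarrow> complex) set" where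
  "Da_space = {a. \<forall>\<sigma>>0. dirichlet_norm \<sigma> a < \<infinity>}"

text \<open>Functions on \<open>K\<close> are represented by total functions whose values outside \<open>K\<close> are irrelevant.\<close>

definition A_space :: "complex set \<Rightarrow> (complex \<Rightarrow> complex) set" where
  "A_space K = {g. continuous_on K g \<and> g holomorphic_on interior K}"

definition sup_norm_on :: "complex set \<Rightarrow> (complex \<Rightarrow> complex) \<Rightarrow> ennreal" where
  "sup_norm_on K u = (SUP s\<in>K. ennreal (norm (u s)))"

end

theory Submission
  imports Defs "HOL-Complex_Analysis.Complex_Analysis"
begin

text \<open>
  Subtracting a long partial sum of the given series from \<open>g\<close> reduces the theorem to the case
  \<open>f = 0\<close>: a Dirichlet polynomial is sought that is close to \<open>g\<close> on \<open>K\<close> and has small norm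
  \<open>\<Sum>n. \<bar>a n\<bar> * n powr -\<sigma>\<close>.

  Put \<open>w = exp (-a * s)\<close> with \<open>a > 0\<close> so small that this map is injective on \<open>K\<close>. A polynomial
  \<open>P = \<Sum>k. c k * w ^ k\<close> is then an exponential sum with frequencies \<open>a * k\<close>, and Cauchy's estimates
  bound its norm \<open>\<Sum>k. \<bar>c k\<bar> * exp (-a * k * \<sigma>)\<close> by the maximum of \<open>\<bar>P\<bar>\<close> on a disc of radius \<open>\<rho>\<close>
  between \<open>exp (-a * \<sigma>)\<close> and \<open>1\<close>. Since \<open>Re s \<le> 0\<close> on \<open>K\<close>, the image \<open>L\<close> of \<open>K\<close> lies outside the
  open unit disc. So \<open>P\<close> has to approximate \<open>0\<close> on a disc and \<open>g (- Ln w / a)\<close> on the disjoint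
  set \<open>L\<close>, and Mergelyan's theorem provides it, the complement of the union being connected
  (\<open>exponential_sum_approximation\<close>). Finally \<open>exp (-x * s)\<close> is the value at \<open>y = exp x\<close> of
  \<open>y powr -s\<close>. Lagrange interpolation at \<open>m\<close> consecutive integers near \<open>y\<close>, with \<open>m\<close> large compared
  with \<open>K\<close>, replaces it by a Dirichlet polynomial; both the error on \<open>K\<close> and the norm are at most
  \<open>C * exp (-x * \<sigma>)\<close> with \<open>C\<close> independent of \<open>x\<close> (\<open>exponential_dirichlet_approximation\<close>). The bound
  on the coefficients \<open>c k\<close> therefore controls both quantities for the whole sum. (A first application
  of Mergelyan's theorem, on \<open>K\<close>, allows \<open>g\<close> to be taken as a polynomial in this argument.)

  Mergelyan's theorem itself is proved by Vitushkin's localization. Extend the function to a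
  continuous \<open>f\<close> of compact support, let \<open>\<omega>\<close> be its oscillation at distance \<open>\<delta>\<close>, and let
  \<open>\<psi> \<zeta>\<close> be a multiple of the integral of \<open>f\<close> over the circle of radius \<open>\<delta>\<close> about \<open>\<zeta>\<close>. Fubini's theorem and the winding number of
  a circle show that the Cauchy transform \<open>\<integral> \<psi> \<zeta> / (z - \<zeta>)\<close> is the average of \<open>f\<close> over the disc of
  radius \<open>\<delta>\<close> about \<open>z\<close> (\<open>cauchy_transform_density\<close>), hence within \<open>\<omega>\<close> of \<open>f z\<close>. The density is at most
  \<open>\<omega> / (pi * \<delta>)\<close>, and by Cauchy's theorem it vanishes at \<open>\<zeta>\<close> unless some \<open>c\<close> outside \<open>K\<close> is within
  \<open>\<delta>\<close> of \<open>\<zeta>\<close>. Near such a \<open>c\<close> the kernel \<open>1 / (z - \<zeta>)\<close> is replaced by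
  \<open>G z + (\<zeta> - b) * (G z)\<^sup>2\<close>, where \<open>G\<close> is a uniform limit of polynomials on \<open>K\<close>
  and the two kernels agree up to order \<open>\<delta>\<^sup>2 / \<bar>z - \<zeta>\<bar> ^ 3\<close> (\<open>localized_cauchy_kernel\<close>). The integral of
  the discrepancy is \<open>O(\<delta>)\<close>, so the total error is \<open>O(\<omega>)\<close>. The function \<open>G\<close> comes from a
  branch of the square root of \<open>(z - c) * (z - q)\<close>, where \<open>q\<close> is joined to \<open>c\<close> outside \<open>K\<close> at distance comparable to \<open>\<delta>\<close>; it plays
  the role of the inverse Joukowski map for an arc from \<open>c\<close> to \<open>q\<close>.
\<close>

section \<open>Uniform limits of polynomials on a compact set\<close>

definition poly_approx :: "complex set \<Rightarrow> (complex \<Rightarrow> complex) set" where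
  "poly_approx K = {f. \<forall>e>0. \<exists>p. \<forall>z\<in>K. norm (poly p z - f z) < e}"

lemma poly_approxI:
  assumes "\<And>e. e > 0 \<Longrightarrow> \<exists>p. \<forall>z\<in>K. norm (poly p z - f z) < e"
  shows "f \<in> poly_approx K"
  using assms by (auto simp: poly_approx_def)

lemma poly_approxE:
  assumes "f \<in> poly_approx K" "e > 0"
  obtains p where "\<And>z. z \<in> K \<Longrightarrow> norm (poly p z - f z) < e"
  using assms unfolding poly_approx_def by blast

lemma poly_in_poly_approx: "poly p \<in> poly_approx K"
  by (rule poly_approxI) (auto intro!: exI[of _ p])

lemma poly_approx_cong:
  assumes "f \<in> poly_approx K" "\<And>z. z \<in> K \<Longrightarrow> f z = g z"
  shows "g \<in> poly_approx K"
  using assms by (auto simp: poly_approx_def)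

lemma poly_approx_uniform_closure:
  assumes "\<And>e. e > 0 \<Longrightarrow> \<exists>g\<in>poly_approx K. \<forall>z\<in>K. norm (g z - f z) < e"
  shows "f \<in> poly_approx K"
proof (rule poly_approxI)
  fix e :: real assume e: "e > 0"
  then obtain g where g: "g \<in> poly_approx K" "\<forall>z\<in>K. norm (g z - f z) < e/2"
    using assms[of "e/2"] by auto
  obtain p where p: "\<And>z. z \<in> K \<Longrightarrow> norm (poly p z - g z) < e/2"
    using poly_approxE[OF g(1), of "e/2"] e by auto
  have "norm (poly p z - f z) < e" if "z \<in> K" for z
    using norm_triangle_lt[of "poly p z - g z" "g z - f z" e] p[OF that] g(2) that by fastforce
  then show "\<exists>p. \<forall>z\<in>K. norm (poly p z - f z) < e" by blast
qed

lemma poly_approx_bounded: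
  assumes "compact K" "f \<in> poly_approx K"
  obtains B where "B > 0" "\<And>z. z \<in> K \<Longrightarrow> norm (f z) \<le> B"
proof -
  obtain p where p: "\<And>z. z \<in> K \<Longrightarrow> norm (poly p z - f z) < 1"
    using poly_approxE[OF assms(2), of 1] by auto
  have "compact (poly p ` K)"
    by (intro compact_continuous_image assms continuous_intros)
  then obtain B where B: "\<And>z. z \<in> K \<Longrightarrow> norm (poly p z) \<le> B"
    using compact_imp_bounded bounded_iff by (metis imageI)
  have "norm (f z) \<le> \<bar>B\<bar> + 1" if "z \<in> K" for z
    using norm_triangle_ineq3[of "poly p z" "f z"] p[OF that] B[OF that] by linarith
  then show ?thesis by (intro that[of "\<bar>B\<bar>+1"]) auto
qed

lemma poly_approx_const: "(\<lambda>_. c) \<in> poly_approx K"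
  by (rule poly_approx_cong[OF poly_in_poly_approx[of "[:c:]"]]) simp

lemma poly_approx_id: "(\<lambda>z. z) \<in> poly_approx K"
  by (rule poly_approx_cong[OF poly_in_poly_approx[of "[:0,1:]"]]) simp

lemma poly_approx_add:
  assumes "f \<in> poly_approx K" "g \<in> poly_approx K"
  shows "(\<lambda>z. f z + g z) \<in> poly_approx K"
proof (rule poly_approxI)
  fix e :: real assume e: "e > 0"
  obtain p where p: "\<And>z. z \<in> K \<Longrightarrow> norm (poly p z - f z) < e/2"
    using poly_approxE[OF assms(1), of "e/2"] e by auto
  obtain q where q: "\<And>z. z \<in> K \<Longrightarrow> norm (poly q z - g z) < e/2"
    using poly_approxE[OF assms(2), of "e/2"] e by auto
  have "norm (poly (p + q) z - (f z + g z)) < e" if "z \<in> K" for z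
    using norm_triangle_lt[of "poly p z - f z" "poly q z - g z" e] p[OF that] q[OF that]
    by (simp add: algebra_simps)
  then show "\<exists>p. \<forall>z\<in>K. norm (poly p z - (f z + g z)) < e" by blast
qed

lemma poly_approx_mult:
  assumes K: "compact K" and "f \<in> poly_approx K" "g \<in> poly_approx K"
  shows "(\<lambda>z. f z * g z) \<in> poly_approx K"
proof (rule poly_approxI)
  fix e :: real assume e: "e > 0"
  obtain B where B: "B > 0" "\<And>z. z \<in> K \<Longrightarrow> norm (f z) \<le> B"
    using poly_approx_bounded[OF K assms(2)] by blast
  obtain q where q: "\<And>z. z \<in> K \<Longrightarrow> norm (poly q z - g z) < e / (2 * B)"
    using poly_approxE[OF assms(3), of "e/(2*B)"] e B by auto
  obtain C where C: "C > 0" "\<And>z. z \<in> K \<Longrightarrow> norm (poly q z) \<le> C"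
    using poly_approx_bounded[OF K poly_in_poly_approx] by blast
  obtain p where p: "\<And>z. z \<in> K \<Longrightarrow> norm (poly p z - f z) < e / (2 * C)"
    using poly_approxE[OF assms(2), of "e/(2*C)"] e C by auto
  have "norm (poly (p * q) z - f z * g z) < e" if z: "z \<in> K" for z
  proof -
    have "poly (p * q) z - f z * g z = (poly p z - f z) * poly q z + f z * (poly q z - g z)"
      by (simp add: algebra_simps)
    moreover have "norm ((poly p z - f z) * poly q z) \<le> e / (2 * C) * C"
      unfolding norm_mult using p[OF z] C(2)[OF z] C(1) e by (intro mult_mono) auto
    moreover have "norm (f z * (poly q z - g z)) < B * (e / (2 * B))"
      unfolding norm_mult using q[OF z] B(2)[OF z] B(1)
      by (intro le_less_trans[OF mult_right_mono mult_strict_left_mono]) auto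
    ultimately show ?thesis
      using norm_triangle_ineq[of "(poly p z - f z) * poly q z" "f z * (poly q z - g z)"] B C by simp
  qed
  then show "\<exists>p. \<forall>z\<in>K. norm (poly p z - f z * g z) < e" by blast
qed

lemma poly_approx_cmult: "f \<in> poly_approx K \<Longrightarrow> compact K \<Longrightarrow> (\<lambda>z. c * f z) \<in> poly_approx K"
  using poly_approx_mult[OF _ poly_approx_const] by blast

lemma poly_approx_diff:
  assumes "compact K" "f \<in> poly_approx K" "g \<in> poly_approx K"
  shows "(\<lambda>z. f z - g z) \<in> poly_approx K"
  using poly_approx_add[OF assms(2) poly_approx_cmult[OF assms(3,1), of "-1"]] by simp

lemma poly_approx_sum:
  assumes "\<And>i. i \<in> I \<Longrightarrow> f i \<in> poly_approx K"
  shows "(\<lambda>z. \<Sum>i\<in>I. f i z) \<in> poly_approx K"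
  using assms by (induction I rule: infinite_finite_induct) (auto intro: poly_approx_const poly_approx_add)

lemma poly_approx_power:
  assumes "compact K" "f \<in> poly_approx K"
  shows "(\<lambda>z. f z ^ n) \<in> poly_approx K"
  using assms by (induction n) (auto intro: poly_approx_const poly_approx_mult)

text \<open>
  Any uniform limit of polynomials may be applied to a member of the algebra: replace the outer
  function by a polynomial, which stays inside the algebra.
\<close>

lemma poly_approx_compose:
  assumes K: "compact K" and f: "f \<in> poly_approx K" and h: "h \<in> poly_approx L"
    and sub: "\<And>z. z \<in> K \<Longrightarrow> f z \<in> L"
  shows "(\<lambda>z. h (f z)) \<in> poly_approx K"
proof (rule poly_approx_uniform_closure)
  fix e :: real assume "e > 0"
  then obtain p where p: "\<And>z. z \<in> L \<Longrightarrow> norm (poly p z - h z) < e"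
    using poly_approxE[OF h] by blast
  have "(\<lambda>z. poly p (f z)) \<in> poly_approx K"
    unfolding poly_altdef
    by (intro poly_approx_sum poly_approx_cmult poly_approx_power K f)
  then show "\<exists>g\<in>poly_approx K. \<forall>z\<in>K. norm (g z - h (f z)) < e"
    by (rule bexI[rotated]) (simp add: p sub)
qed

text \<open>
  Taylor polynomials converge uniformly on smaller concentric discs.
\<close>

lemma holomorphic_in_poly_approx_cball:
  assumes h: "h holomorphic_on ball 0 R" and "\<rho> < R"
  shows "h \<in> poly_approx (cball 0 \<rho>)"
proof (cases "\<rho> \<ge> 0")
  case True
  define a where "a = (\<lambda>n. (deriv ^^ n) h 0 / fact n)"
  have sums: "(\<lambda>n. a n * w ^ n) sums h w" if "norm w < R" for w
    using holomorphic_power_series[OF h, of w] that by (simp add: a_def)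
  have "uniform_limit (cball 0 \<rho>) (\<lambda>n w. \<Sum>k<n. a k * w ^ k) (\<lambda>w. \<Sum>k. a k * w ^ k) sequentially"
  proof (rule Weierstrass_m_test)
    have "norm (of_real ((\<rho> + R)/2) :: complex) = (\<rho> + R)/2"
      using True \<open>\<rho> < R\<close> by (subst norm_of_real) auto
    then have "summable (\<lambda>n. a n * of_real ((\<rho> + R)/2) ^ n)"
      using sums[of "of_real ((\<rho> + R)/2)"] \<open>\<rho> < R\<close> True by (auto simp: sums_iff)
    then show "summable (\<lambda>n. norm (a n * of_real \<rho> ^ n))"
      by (rule powser_insidea) (use \<open>norm _ = (\<rho> + R)/2\<close> True \<open>\<rho> < R\<close> in auto)
    show "norm (a n * w ^ n) \<le> norm (a n * of_real \<rho> ^ n)" if "w \<in> cball 0 \<rho>" for n w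
      using that True by (auto simp: norm_mult norm_power intro!: mult_left_mono power_mono)
  qed
  then have ul: "uniform_limit (cball 0 \<rho>) (\<lambda>n w. \<Sum>k<n. a k * w ^ k) h sequentially"
    by (rule uniform_limit_cong'[THEN iffD1, rotated -1]) (use sums \<open>\<rho> < R\<close> in \<open>auto simp: sums_iff\<close>)
  show ?thesis
  proof (rule poly_approx_uniform_closure)
    fix e :: real assume "e > 0"
    from uniform_limitD[OF ul this] obtain n where
      "\<forall>w\<in>cball 0 \<rho>. dist (\<Sum>k<n. a k * w ^ k) (h w) < e"
      by (auto simp: eventually_at_top_linorder)
    moreover have "(\<lambda>w. \<Sum>k<n. a k * w ^ k) \<in> poly_approx (cball 0 \<rho>)"
      by (intro poly_approx_sum poly_approx_cmult poly_approx_power poly_approx_id compact_cball)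
    ultimately show "\<exists>g\<in>poly_approx (cball 0 \<rho>). \<forall>z\<in>cball 0 \<rho>. norm (g z - h z) < e"
      by (force simp: dist_norm)
  qed
next
  case False
  then have "cball (0::complex) \<rho> = {}" by simp
  then show ?thesis by (simp add: poly_approx_def)
qed

lemma poly_approx_compose_holomorphic:
  assumes "compact K" "f \<in> poly_approx K" "h holomorphic_on ball 0 R" "\<rho> < R"
    and "\<And>z. z \<in> K \<Longrightarrow> norm (f z) \<le> \<rho>"
  shows "(\<lambda>z. h (f z)) \<in> poly_approx K"
  by (rule poly_approx_compose[OF assms(1,2) holomorphic_in_poly_approx_cball[OF assms(3,4)]])
     (use assms(5) in simp)

lemma poly_approx_geometric:
  assumes "compact K" "f \<in> poly_approx K" "\<rho> < 1" "\<And>z. z \<in> K \<Longrightarrow> norm (f z) \<le> \<rho>"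
  shows "(\<lambda>z. 1 / (1 - f z)) \<in> poly_approx K"
proof -
  have "(\<lambda>w. 1 / (1 - w :: complex)) holomorphic_on ball 0 1"
    by (intro holomorphic_intros) auto
  from poly_approx_compose_holomorphic[OF assms(1,2) this assms(3,4)] show ?thesis by simp
qed

text \<open>
  Moving a pole by less than its distance to \<open>K\<close> amounts to multiplication by the sum of a uniformly
  convergent geometric series in \<open>(w' - w) / (z - w)\<close>.
\<close>

lemma poly_approx_pole_step:
  assumes K: "compact K" and w: "(\<lambda>z. 1 / (z - w)) \<in> poly_approx K"
    and d: "\<And>z. z \<in> K \<Longrightarrow> d \<le> norm (z - w)" "norm (w' - w) < d"
  shows "(\<lambda>z. 1 / (z - w')) \<in> poly_approx K"
proof -
  define f where "f = (\<lambda>z. (w' - w) * (1 / (z - w)))"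
  have d0: "d > 0" using d(2) by (meson norm_ge_zero le_less_trans)
  have f: "f \<in> poly_approx K" unfolding f_def by (rule poly_approx_cmult[OF w K])
  have le: "norm (f z) \<le> norm (w' - w) / d" if "z \<in> K" for z
    unfolding f_def norm_mult norm_divide using d(1)[OF that] d0
    by (simp add: frac_le)
  have "norm (w' - w) / d < 1" using d(2) d0 by simp
  then have "(\<lambda>z. 1 / (1 - f z)) \<in> poly_approx K"
    by (rule poly_approx_geometric[OF K f _ le])
  then have "(\<lambda>z. 1 / (z - w) * (1 / (1 - f z))) \<in> poly_approx K"
    by (rule poly_approx_mult[OF K w])
  then show ?thesis
  proof (rule poly_approx_cong)
    fix z assume "z \<in> K"
    then have "z \<noteq> w" "z \<noteq> w'" using d(1)[of z] d(2) d0 by (auto simp: norm_minus_commute)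
    then show "1 / (z - w) * (1 / (1 - f z)) = 1 / (z - w')"
      by (simp add: f_def divide_simps) 
  qed
qed

lemma dist_to_compact_pos:
  fixes K :: "complex set"
  assumes "compact K" "w \<notin> K"
  obtains d where "d > 0" "\<And>z. z \<in> K \<Longrightarrow> d \<le> norm (z - w)"
proof -
  have "open (- K)" using assms compact_imp_closed by blast
  then obtain d where "d > 0" "ball w d \<subseteq> - K" using assms openE by blast
  then show ?thesis by (intro that[of d]) (force simp: dist_norm norm_minus_commute subset_iff not_less)+
qed

text \<open>
  Runge's pole pushing: far from \<open>K\<close> the function \<open>1 / (z - w)\<close> is a geometric series in \<open>z\<close>, and
  the set of admissible poles is open and closed in the connected complement.
\<close>

lemma poly_approx_simple_pole:
  assumes K: "compact K" and conn: "connected (- K)" and w: "w \<notin> K"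
  shows "(\<lambda>z. 1 / (z - w)) \<in> poly_approx K"
proof -
  obtain R where R: "R > 0" "\<And>z. z \<in> K \<Longrightarrow> norm z \<le> R"
    using poly_approx_bounded[OF K poly_approx_id] by blast
  \<comment> \<open>A pole so far away that \<open>\<bar>z / w0\<bar> \<le> 1/2\<close> on \<open>K\<close>.\<close>
  define w0 where "w0 = (of_real (2 * R) :: complex)"
  have nw0: "norm w0 = 2 * R" using R by (simp add: w0_def)
  have "w0 \<notin> K" using R nw0 by fastforce
  have start: "(\<lambda>z. 1 / (z - w0)) \<in> poly_approx K"
  proof -
    have "(\<lambda>z. 1 / (1 - (1 / w0) * z)) \<in> poly_approx K"
    proof (rule poly_approx_geometric[where \<rho> = "1/2"])
      show "norm ((1 / w0) * z) \<le> 1 / 2" if "z \<in> K" for z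
        using R(2)[OF that] R(1) by (simp add: norm_mult norm_divide nw0 divide_simps)
    qed (rule K poly_approx_cmult[OF poly_approx_id K] | simp)+
    then have "(\<lambda>z. (-1 / w0) * (1 / (1 - (1 / w0) * z))) \<in> poly_approx K"
      by (rule poly_approx_cmult[OF _ K])
    then show ?thesis
    proof (rule poly_approx_cong)
      fix z assume "z \<in> K"
      then have "z \<noteq> w0" "w0 \<noteq> 0" using \<open>w0 \<notin> K\<close> R by (auto simp: w0_def)
      then show "(-1 / w0) * (1 / (1 - (1 / w0) * z)) = 1 / (z - w0)"
        by (simp add: divide_simps)
    qed
  qed
  define R where "R = (\<lambda>a b. (\<lambda>z. 1 / (z - a)) \<in> poly_approx K \<longleftrightarrow> (\<lambda>z. 1 / (z - b)) \<in> poly_approx K)"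
  have "R w0 w"
  proof (rule connected_equivalence_relation[OF conn])
    fix a assume "a \<in> - K"
    then obtain d where d: "d > 0" "\<And>z. z \<in> K \<Longrightarrow> d \<le> norm (z - a)"
      using dist_to_compact_pos[OF K] by blast
    have "R a b" if "norm (b - a) < d/2" for b
    proof -
      have "d / 2 \<le> norm (z - b)" if "z \<in> K" for z
        using norm_triangle_ineq[of "z - b" "b - a"] d(2)[OF that] \<open>norm (b - a) < d/2\<close> by simp
      then show ?thesis
        using poly_approx_pole_step[OF K, of a d b] poly_approx_pole_step[OF K, of b "d/2" a] that d
        by (auto simp: R_def norm_minus_commute)
    qed
    then have "\<forall>b\<in>ball a (d/2) \<inter> - K. R a b"
      by (auto simp: dist_norm norm_minus_commute)
    then show "\<exists>T. openin (top_of_set (- K)) T \<and> a \<in> T \<and> (\<forall>b\<in>T. R a b)"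
      using d \<open>a \<in> - K\<close> by (intro exI[of _ "ball a (d/2) \<inter> - K"]) (auto simp: Int_commute)
  qed (use \<open>w0 \<notin> K\<close> w in \<open>auto simp: R_def\<close>)
  then show ?thesis using start by (simp add: R_def)
qed

section \<open>Square roots with two branch points outside the compact set\<close>

text \<open>
  The square roots of two numbers in the right half-plane have arguments in \<open>(-pi/4, pi/4)\<close>, so
  their quotient stays in the right half-plane and is the principal root.
\<close>

lemma csqrt_quotient:
  assumes "Re a > 0" "Re b > 0"
  shows "csqrt (a / b) = csqrt a / csqrt b"
proof (rule csqrt_unique)
  show "(csqrt a / csqrt b)\<^sup>2 = a / b" by (simp add: power_divide)
  have *: "Re (csqrt c) > \<bar>Im (csqrt c)\<bar>" if "Re c > 0" for c
  proof -
    have "Re ((csqrt c)\<^sup>2) > 0" using that by simp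
    then have "(Re (csqrt c))\<^sup>2 > (Im (csqrt c))\<^sup>2" unfolding Re_power2 by simp
    then show ?thesis using Re_csqrt[of c] abs_le_square_iff[of "Re (csqrt c)" "Im (csqrt c)"] by linarith
  qed
  define x y u v where "x = Re (csqrt a)" "y = Im (csqrt a)" "u = Re (csqrt b)" "v = Im (csqrt b)"
  have "x > \<bar>y\<bar>" "u > \<bar>v\<bar>" using * assms unfolding x_y_u_v_def by auto
  then have "x * u > \<bar>y\<bar> * \<bar>v\<bar>" by (intro mult_strict_mono') auto
  then have "\<bar>y * v\<bar> < x * u" by (simp only: abs_mult)
  then have "x * u + y * v > 0" by linarith
  moreover have "u\<^sup>2 + v\<^sup>2 > 0" using \<open>u > \<bar>v\<bar>\<close> by (intro add_pos_nonneg) auto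
  ultimately show "0 < Re (csqrt a / csqrt b) \<or> Re (csqrt a / csqrt b) = 0 \<and> 0 \<le> Im (csqrt a / csqrt b)"
    by (simp add: Re_divide x_y_u_v_def)
qed

text \<open>
  If the component stayed within distance \<open>r / 2\<close> of \<open>c\<close>, it would be open and closed in the
  complement of \<open>K\<close>, hence all of it; but that complement is unbounded.
\<close>

lemma exists_far_point_in_component:
  fixes K :: "complex set"
  assumes K: "compact K" and conn: "connected (- K)" and c: "c \<notin> K" and r: "r > 0"
  obtains q where "q \<in> connected_component_set (ball c r - K) c" "r / 2 \<le> norm (q - c)"
proof -
  define U where "U = connected_component_set (ball c r - K) c"
  have op: "open (ball c r - K)" using K compact_imp_closed by blast
  then have oU: "open U" unfolding U_def by (rule open_connected_component)
  have cU: "c \<in> U" using c r by (simp add: U_def connected_component_refl)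
  have Usub: "U \<subseteq> ball c r - K" unfolding U_def by (rule connected_component_subset)
  have "\<exists>q\<in>U. r / 2 \<le> norm (q - c)"
  proof (rule ccontr)
    assume "\<not> ?thesis"
    then have small: "U \<subseteq> cball c (r/2)" by (force simp: dist_norm norm_minus_commute)
    have "x \<in> U" if x: "x \<in> closure U" "x \<notin> K" for x
    proof -
      have "x \<in> cball c (r/2)" using x(1) small closure_minimal closed_cball by blast
      then have "x \<in> ball c r - K" using x r by auto
      then obtain e where e: "e > 0" "ball x e \<subseteq> ball c r - K" using op openE by blast
      obtain y where y: "y \<in> U" "y \<in> ball x e"
        using x(1) e(1) closure_approachable by (metis dist_commute mem_ball)
      have "connected_component (ball c r - K) y x"
        using e y(2) by (intro connected_component_of_subset[OF _ e(2)])
           (auto simp: connected_component_def intro!: exI[of _ "ball x e"])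
      then show ?thesis using y(1) unfolding U_def
        by (metis connected_component_trans mem_Collect_eq)
    qed
    then have "closedin (top_of_set (- K)) U"
      using Usub by (intro closedin_closed[THEN iffD2] exI[of _ "closure U"]) (use closure_subset in auto)
    moreover have "openin (top_of_set (- K)) U"
      using oU Usub by (intro openin_open[THEN iffD2] exI[of _ U]) auto
    ultimately have "U = - K" using conn cU by (auto simp: connected_clopen)
    then have "bounded (- K)" using small bounded_cball bounded_subset by blast
    then have "bounded (UNIV :: complex set)"
      using compact_imp_bounded[OF K] by (metis bounded_Un Compl_partition)
    then show False by simp
  qed
  then show ?thesis using that unfolding U_def by blast
qed

text \<open>
  Over a short step from \<open>p\<close> to \<open>x\<close> the root of \<open>(z - x) / (z - p)\<close> is a principal root of a small
  perturbation of \<open>1\<close>; multiplying such roots along a chain of steps outside \<open>K\<close> leads from \<open>c\<close>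
  to \<open>q\<close>. The value prescribed for \<open>r \<le> \<bar>z - c\<bar>\<close> pins down the sign of the root far away, which is
  what the expansion of the kernel at infinity depends on; it is carried along the chain
  as a quotient of principal roots that involves only the two end points of a step.
\<close>

lemma sqrt_branch:
  fixes K :: "complex set"
  assumes K: "compact K" and conn: "connected (- K)" and c: "c \<notin> K" and r: "r > 0"
    and q: "q \<in> connected_component_set (ball c r - K) c"
  obtains T where "T \<in> poly_approx K" "\<And>z. z \<in> K \<Longrightarrow> (T z)\<^sup>2 = (z - q) / (z - c)"
    "\<And>z. z \<in> K \<Longrightarrow> r \<le> norm (z - c) \<Longrightarrow> T z = csqrt (1 - (q - c) / (z - c))"
proof -
  define U where "U = connected_component_set (ball c r - K) c"
  have op: "open (ball c r - K)" using K compact_imp_closed by blast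
  then have oU: "open U" unfolding U_def by (rule open_connected_component)
  have cU: "c \<in> U" using c r by (simp add: U_def connected_component_refl)
  have Usub: "U \<subseteq> ball c r - K" unfolding U_def by (rule connected_component_subset)
  define s where "s = (\<lambda>p z. csqrt (1 - (p - c) / (z - c)))"
  have arg: "Re (1 - (p - c) / (z - c)) > 0" if "p \<in> U" "r \<le> norm (z - c)" for p z
  proof -
    have "norm ((p - c) / (z - c)) < 1"
    proof -
      have "norm (p - c) < norm (z - c)"
        using subsetD[OF Usub that(1)] that(2) by (simp add: dist_norm norm_minus_commute)
      moreover from this have "norm (z - c) > 0" by (meson norm_ge_zero le_less_trans)
      ultimately show "norm ((p - c) / (z - c)) < 1" unfolding norm_divide by simp
    qed
    then show ?thesis using complex_Re_le_cmod[of "(p - c) / (z - c)"] by simp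
  qed
  have s0: "s p z \<noteq> 0" if "p \<in> U" "r \<le> norm (z - c)" for p z
    using arg[OF that] by (auto simp: s_def)
  define B where "B = (\<lambda>p q T. \<forall>z\<in>K.
     (T z)\<^sup>2 = (z - q) / (z - p) \<and> (r \<le> norm (z - c) \<longrightarrow> T z = s q z / s p z))"
  have B_sq: "(T z)\<^sup>2 = (z - q) / (z - p)" if "B p q T" "z \<in> K" for p q T z
    using that by (simp add: B_def)
  have B_far: "T z = s q z / s p z" if "B p q T" "z \<in> K" "r \<le> norm (z - c)" for p q T z
    using that by (simp add: B_def)
  define R where "R = (\<lambda>p q. \<exists>T\<in>poly_approx K. B p q T)"
  have "R c q"
  proof (rule connected_equivalence_relation[where R = R and S = U])
    show "connected U" unfolding U_def by (rule connected_connected_component)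
    show "R x z" if R: "R x y" "R y z" and U: "x \<in> U" "y \<in> U" "z \<in> U" for x y z
    proof -
      obtain S where S: "S \<in> poly_approx K" "B x y S" using R(1) unfolding R_def by blast
      obtain T where T: "T \<in> poly_approx K" "B y z T" using R(2) unfolding R_def by blast
      note ST = B_sq[OF S(2)] B_sq[OF T(2)] B_far[OF S(2)] B_far[OF T(2)]
      have ne: "w \<noteq> y" if "w \<in> K" for w using U Usub that by auto
      show ?thesis unfolding R_def B_def
      proof (intro bexI[of _ "\<lambda>w. S w * T w"] ballI conjI impI)
        show "(\<lambda>w. S w * T w) \<in> poly_approx K" by (rule poly_approx_mult[OF K S(1) T(1)])
        show "(S w * T w)\<^sup>2 = (w - z) / (w - x)" if "w \<in> K" for w
          using ne[OF that] by (simp add: power_mult_distrib ST that)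
        show "S w * T w = s z w / s x w" if "w \<in> K" "r \<le> norm (w - c)" for w
          using s0[OF U(2) that(2)] by (simp add: ST that)
      qed
    qed
    show "R y x" if R: "R x y" and U: "x \<in> U" "y \<in> U" for x y
    proof -
      obtain S where S: "S \<in> poly_approx K" "B x y S" using R unfolding R_def by blast
      note S' = B_sq[OF S(2)] B_far[OF S(2)]
      have ne: "w \<noteq> y" "w \<noteq> x" if "w \<in> K" for w using U Usub that by auto
      have pole: "(\<lambda>w. 1 / (w - y)) \<in> poly_approx K"
        using U Usub by (intro poly_approx_simple_pole[OF K conn]) auto
      have P: "(\<lambda>w. S w * ((w - x) * (1 / (w - y)))) \<in> poly_approx K"
        by (rule poly_approx_mult[OF K S(1) poly_approx_mult[OF K poly_approx_diff[OF K poly_approx_id poly_approx_const] pole]])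
      show ?thesis unfolding R_def B_def
      proof (rule bexI[OF _ P], intro ballI conjI impI)
        show "(S w * ((w - x) * (1 / (w - y))))\<^sup>2 = (w - x) / (w - y)" if "w \<in> K" for w
          unfolding power_mult_distrib S'(1)[OF that]
          using ne[OF that] by (simp add: power_divide divide_simps power2_eq_square)
        show "S w * ((w - x) * (1 / (w - y))) = s x w / s y w" if "w \<in> K" "r \<le> norm (w - c)" for w
        proof -
          have "(s y w / s x w)\<^sup>2 = (w - y) / (w - x)" using S'(1)[OF that(1)] S'(2)[OF that] by simp
          moreover have "s y w \<noteq> 0" "s x w \<noteq> 0" using s0 U that by auto
          ultimately have "(w - x) * (1 / (w - y)) = (s x w / s y w)\<^sup>2"
            using ne[OF that(1)] by (simp add: power_divide divide_simps) (simp only: mult.commute)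
          then show ?thesis unfolding S'(2)[OF that]
            using \<open>s y w \<noteq> 0\<close> \<open>s x w \<noteq> 0\<close> by (simp add: power2_eq_square)
        qed
      qed
    qed
    fix p assume p: "p \<in> U"
    then have "p \<notin> K" using Usub by auto
    then obtain d where d: "d > 0" "\<And>z. z \<in> K \<Longrightarrow> d \<le> norm (z - p)"
      using dist_to_compact_pos[OF K] by blast
    have "R p x" if x: "x \<in> U" "norm (x - p) < d" for x
    proof -
      define f where "f = (\<lambda>z. (x - p) * (1 / (z - p)))"
      have f: "f \<in> poly_approx K" unfolding f_def
        by (rule poly_approx_cmult[OF poly_approx_simple_pole[OF K conn \<open>p \<notin> K\<close>] K])
      have le: "norm (f z) \<le> norm (x - p) / d" if "z \<in> K" for z
        unfolding f_def norm_mult norm_divide using d(2)[OF that] d(1) by (simp add: frac_le)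
      have lt: "norm (x - p) / d < 1" using x d by simp
      have "(\<lambda>w. csqrt (1 - w)) holomorphic_on ball 0 1"
      proof (intro holomorphic_intros)
        fix w :: complex assume "w \<in> ball 0 1"
        then have "Re (1 - w) > 0" using complex_Re_le_cmod[of w] by simp
        then show "1 - w \<notin> \<real>\<^sub>\<le>\<^sub>0" by (auto simp: complex_nonpos_Reals_iff)
      qed
      from poly_approx_compose_holomorphic[OF K f this lt le]
      have T: "(\<lambda>z. csqrt (1 - f z)) \<in> poly_approx K" by simp
      have ne: "w \<noteq> p" if "w \<in> K" for w using \<open>p \<notin> K\<close> that by auto
      have f1: "1 - f z = (z - x) / (z - p)" if "z \<in> K" for z
        using ne[OF that] by (simp add: f_def divide_simps)
      show "R p x" unfolding R_def B_def
      proof (rule bexI[OF _ T], intro ballI conjI impI)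
        show "(csqrt (1 - f z))\<^sup>2 = (z - x) / (z - p)" if "z \<in> K" for z
          using f1[OF that] by simp
        show "csqrt (1 - f z) = s x z / s p z" if z: "z \<in> K" "r \<le> norm (z - c)" for z
        proof -
          have "z \<noteq> c" using z r by auto
          then have "1 - (y - c) / (z - c) = (z - y) / (z - c)" for y by (simp add: divide_simps)
          then have "1 - f z = (1 - (x - c) / (z - c)) / (1 - (p - c) / (z - c))"
            using f1[OF z(1)] ne[OF z(1)] \<open>z \<noteq> c\<close> by simp
          then show ?thesis using csqrt_quotient[OF arg[OF x(1) z(2)] arg[OF p z(2)]] by (simp add: s_def)
        qed
      qed
    qed
    then have "\<forall>x\<in>ball p d \<inter> U. R p x" by (auto simp: dist_norm norm_minus_commute)
    then show "\<exists>T. openin (top_of_set U) T \<and> p \<in> T \<and> (\<forall>x\<in>T. R p x)"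
      using d p by (intro exI[of _ "ball p d \<inter> U"]) (auto simp: Int_commute)
  qed (use cU q in \<open>auto simp: U_def\<close>)
  then obtain T where T: "T \<in> poly_approx K" "B c q T" unfolding R_def by blast
  show ?thesis
  proof (rule that[OF T(1)])
    show "(T z)\<^sup>2 = (z - q) / (z - c)" if "z \<in> K" for z by (rule B_sq[OF T(2) that])
    show "T z = csqrt (1 - (q - c) / (z - c))" if "z \<in> K" "r \<le> norm (z - c)" for z
      using B_far[OF T(2) that] by (simp add: s_def)
  qed
qed

section \<open>A kernel that agrees with the Cauchy kernel up to third-order terms\<close>

text \<open>
  With \<open>t = e / v\<close> and \<open>s = sqrt (1 - t)\<close> one has \<open>g = m / v\<close> for \<open>m = 4 / (1 + s)\<^sup>2\<close>, and
  \<open>m = 1 + t / 2 + O(t\<^sup>2)\<close>. Hence \<open>g = 1 / v + e / (2 * v\<^sup>2) + O(1 / v ^ 3)\<close>; the term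
  \<open>(\<eta> - e / 2) * g\<^sup>2\<close> corrects the second coefficient to that of \<open>1 / (v - \<eta>)\<close>.
\<close>

lemma sqrt_kernel_expansion:
  fixes v e \<eta> s :: complex
  assumes s: "s\<^sup>2 = 1 - e / v" "Re s \<ge> 0" and r: "r > 0" "norm e < r" "norm \<eta> < r" "2 * r \<le> norm v" "e \<noteq> 0"
  defines "g \<equiv> 8 / e\<^sup>2 * (v - e / 2 - v * s)"
  shows "norm (g + (\<eta> - e / 2) * g\<^sup>2 - 1 / (v - \<eta>)) \<le> 46 * r\<^sup>2 / norm v ^ 3"
proof -
  define t where "t = e / v"
  define m where "m = 4 / (1 + s)\<^sup>2"
  define V where "V = norm v"
  have V: "V > 0" "2 * r \<le> V" using r by (auto simp: V_def)
  have v0: "v \<noteq> 0" using V by (auto simp: V_def)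
  have tV: "norm t \<le> r / V" using r V by (auto simp: t_def norm_divide V_def intro!: divide_right_mono)
  also have "\<dots> \<le> 1/2" using V r by (simp add: divide_simps)
  finally have t2: "norm t \<le> 1/2" .
  have s1: "norm (1 + s) \<ge> 1" using abs_Re_le_cmod[of "1 + s"] s(2) by simp
  then have s10: "1 + s \<noteq> 0" by auto
  have st: "(1 - s) * (1 + s) = t" using s(1) by (simp add: t_def power2_eq_square algebra_simps)
  then have "1 - s = t / (1 + s)" using s10 by (simp add: field_simps)
  then have st': "norm (1 - s) \<le> norm t" 
    using s1 by (simp add: norm_divide divide_le_eq mult_le_cancel_left1)
  have ns: "norm s \<le> 5/4"
  proof -
    have "norm s ^ 2 = norm (1 - t)" using s(1) by (metis t_def norm_power)
    also have "\<dots> \<le> (5/4)^2" using norm_triangle_ineq4[of 1 t] t2 by (simp add: power2_eq_square)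
    finally show ?thesis by (rule power2_le_imp_le) simp
  qed
  have m4: "norm m \<le> 4" using one_le_power[OF s1, of 2] by (simp add: m_def norm_divide norm_power divide_le_eq)
  have inv: "norm (x / (1 + s)\<^sup>2) \<le> norm x" for x
    using one_le_power[OF s1, of 2] by (simp add: norm_divide norm_power divide_le_eq mult_le_cancel_left1)
  have "m - 1 = (1 - s) * (3 + s) / (1 + s)\<^sup>2" 
  proof -
    have "(m - 1) * (1 + s)\<^sup>2 = m * (1 + s)\<^sup>2 - (1 + s)\<^sup>2" by (simp add: algebra_simps)
    also have "m * (1 + s)\<^sup>2 = 4" using s10 by (simp add: m_def)
    also have "4 - (1 + s)\<^sup>2 = (1 - s) * (3 + s)" by (simp add: algebra_simps power2_eq_square)
    finally show ?thesis using s10 by (simp add: eq_divide_eq)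
  qed
  then have "norm (m - 1) \<le> norm (1 - s) * norm (3 + s)"
    using inv[of "(1 - s) * (3 + s)"] by (simp only: norm_mult)
  also have "\<dots> \<le> norm t * 5" using st' ns norm_triangle_ineq[of 3 s] by (intro mult_mono) auto
  finally have m1: "norm (m - 1) \<le> 5 * norm t" by simp
  have "norm (m\<^sup>2 - 1) = norm (m - 1) * norm (m + 1)"
    by (simp add: norm_mult[symmetric] power2_eq_square algebra_simps)
  also have "\<dots> \<le> (5 * norm t) * 5" using m1 m4 norm_triangle_ineq[of m 1] by (intro mult_mono) auto
  finally have m2: "norm (m\<^sup>2 - 1) \<le> 25 * norm t" by simp
  \<comment> \<open>The numerator \<open>8 - 2 * (1 + s)\<^sup>2 - (1 - s\<^sup>2) * (1 + s)\<^sup>2\<close> has a double zero at \<open>s = 1\<close>.\<close>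
  have "m - 1 - t / 2 = ((1 - s)\<^sup>2 * (s\<^sup>2 + 4 * s + 5) / 2) / (1 + s)\<^sup>2"
  proof -
    have "(m - 1 - t / 2) * (1 + s)\<^sup>2 = m * (1 + s)\<^sup>2 - (1 + t / 2) * (1 + s)\<^sup>2" by (simp add: algebra_simps)
    also have "m * (1 + s)\<^sup>2 = 4" using s10 by (simp add: m_def)
    also have "4 - (1 + t / 2) * (1 + s)\<^sup>2 = (1 - s)\<^sup>2 * (s\<^sup>2 + 4 * s + 5) / 2"
      unfolding st[symmetric] by (simp add: field_simps) algebra
    finally show ?thesis using s10 nonzero_eq_divide_eq[of "(1 + s)\<^sup>2" "m - 1 - t / 2" "(1 - s)\<^sup>2 * (s\<^sup>2 + 4 * s + 5) / 2"]
      by (simp only: power_eq_0_iff) simp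
  qed
  then have "norm (m - 1 - t / 2) \<le> norm ((1 - s)\<^sup>2 * (s\<^sup>2 + 4 * s + 5) / 2)"
    using inv[of "(1 - s)\<^sup>2 * (s\<^sup>2 + 4 * s + 5) / 2"] by (simp only:)
  also have "\<dots> = norm (1 - s) ^ 2 * norm (s\<^sup>2 + 4 * s + 5) / 2" by (simp add: norm_mult norm_power norm_divide)
  also have "\<dots> \<le> norm t ^ 2 * 12 / 2"
  proof -
    have "norm (s\<^sup>2 + 4 * s + 5) \<le> norm s ^ 2 + 4 * norm s + 5"
      using norm_triangle_ineq[of "s\<^sup>2 + 4 * s" 5] norm_triangle_ineq[of "s\<^sup>2" "4 * s"] by (simp add: norm_mult norm_power)
    also have "\<dots> \<le> (5/4)^2 + 4 * (5/4) + 5" using ns by (intro add_mono power_mono) auto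
    also have "\<dots> \<le> 12" by (simp add: power2_eq_square)
    finally show ?thesis using st' by (intro divide_right_mono mult_mono power_mono) auto
  qed
  finally have m3: "norm (m - 1 - t / 2) \<le> 6 * norm t ^ 2" by simp
  have g: "g = m / v"
  proof -
    have e: "e = v * t" using v0 by (simp add: t_def)
    have t0: "t \<noteq> 0" using r v0 by (simp add: t_def)
    have "v - e / 2 - v * s = v * (1 - s) ^ 2 / 2" unfolding e st[symmetric] by (simp add: field_simps power2_eq_square)
    also have "(1 - s)^2 = t^2 / (1 + s)^2" unfolding st[symmetric] using s10 by (simp add: power_mult_distrib)
    finally show ?thesis unfolding g_def using e t0 v0 s10 by (simp add: m_def power_mult_distrib power2_eq_square)
  qed
  have d: "norm (v - \<eta>) \<ge> V / 2" using norm_triangle_ineq2[of v \<eta>] r V by (simp add: V_def)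
  then have d0: "v - \<eta> \<noteq> 0" using V by auto
  have "g + (\<eta> - e / 2) * g\<^sup>2 - 1 / (v - \<eta>) =
     (m - 1 - t / 2) / v + (\<eta> - e / 2) * (m\<^sup>2 - 1) / v\<^sup>2 - \<eta>\<^sup>2 / (v\<^sup>2 * (v - \<eta>))"
  proof -
    define i where "i = 1 / v"
    have "1 / (v - \<eta>) = i + \<eta> * i\<^sup>2 + \<eta>\<^sup>2 / (v\<^sup>2 * (v - \<eta>))"
      using v0 d0 by (simp add: i_def divide_simps) (simp add: algebra_simps power2_eq_square)
    moreover have "g = m * i" "t = e * i" "x / v = x * i" "x / v\<^sup>2 = x * i\<^sup>2" for x
      by (auto simp: g t_def i_def power_divide)
    ultimately show ?thesis by (simp add: algebra_simps power2_eq_square) (simp add: field_simps)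
  qed
  also have "norm \<dots> \<le> norm ((m - 1 - t / 2) / v) + norm ((\<eta> - e / 2) * (m\<^sup>2 - 1) / v\<^sup>2) + norm (\<eta>\<^sup>2 / (v\<^sup>2 * (v - \<eta>)))"
    by (rule order_trans[OF norm_triangle_ineq4]) (intro add_right_mono norm_triangle_ineq)
  also have "\<dots> \<le> 6 * r\<^sup>2 / V ^ 3 + 75/2 * r\<^sup>2 / V ^ 3 + 2 * r\<^sup>2 / V ^ 3"
  proof (intro add_mono)
    have "norm (m - 1 - t / 2) \<le> 6 * (r / V)^2" using m3 tV by (meson mult_left_mono order_trans power_mono norm_ge_zero zero_le_numeral)
    then have "norm ((m - 1 - t / 2) / v) \<le> 6 * (r / V)^2 / V" unfolding norm_divide V_def by (intro divide_right_mono) auto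
    then show "norm ((m - 1 - t / 2) / v) \<le> 6 * r\<^sup>2 / V ^ 3" by (simp add: power2_eq_square power3_eq_cube)
    have "norm (\<eta> - e / 2) \<le> 3/2 * r" using norm_triangle_ineq4[of \<eta> "e / 2"] r by (simp add: norm_divide)
    moreover have "norm (m\<^sup>2 - 1) \<le> 25 * (r / V)" using m2 tV by simp
    ultimately have "norm (\<eta> - e / 2) * norm (m\<^sup>2 - 1) \<le> (3/2 * r) * (25 * (r / V))"
      using r by (intro mult_mono) auto
    then have "norm ((\<eta> - e / 2) * (m\<^sup>2 - 1) / v\<^sup>2) \<le> (3/2 * r) * (25 * (r / V)) / V\<^sup>2"
      unfolding norm_divide norm_mult norm_power V_def by (intro divide_right_mono) auto
    then show "norm ((\<eta> - e / 2) * (m\<^sup>2 - 1) / v\<^sup>2) \<le> 75/2 * r\<^sup>2 / V ^ 3"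
      by (simp add: power2_eq_square power3_eq_cube mult.commute mult.left_commute)
    have "norm (\<eta>\<^sup>2 / (v\<^sup>2 * (v - \<eta>))) \<le> r\<^sup>2 / (V\<^sup>2 * (V / 2))"
      unfolding norm_divide norm_mult norm_power V_def[symmetric] using d V r
      by (intro frac_le mult_left_mono power_mono) auto
    then show "norm (\<eta>\<^sup>2 / (v\<^sup>2 * (v - \<eta>))) \<le> 2 * r\<^sup>2 / V ^ 3"
      by (simp add: power2_eq_square power3_eq_cube mult.commute mult.left_commute)
  qed
  also have "\<dots> \<le> 46 * r\<^sup>2 / V ^ 3" using V by (simp add: field_simps)
  finally show ?thesis by (simp add: V_def)
qed

text \<open>
  For \<open>z\<close> at distance at least \<open>2 * r\<close> from \<open>c\<close> this is the expansion at infinity. Closer to \<open>c\<close> both kernels are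
  estimated separately: \<open>\<bar>(z - c) * T z\<bar>\<^sup>2 = \<bar>z - c\<bar> * \<bar>z - q\<bar>\<close> bounds \<open>g\<close> by a multiple of \<open>1 / r\<close>,
  and there \<open>\<bar>z - \<zeta>\<bar> \<le> 3 * r\<close>. The lower bound \<open>r / 2 \<le> \<bar>q - c\<bar>\<close> enters through the factor \<open>8 / e\<^sup>2\<close>.
\<close>

lemma localized_cauchy_kernel:
  fixes K :: "complex set"
  assumes K: "compact K" and conn: "connected (- K)" and c: "c \<notin> K" and r: "r > 0"
  obtains g b where "g \<in> poly_approx K"
    "\<And>z \<zeta>. z \<in> K \<Longrightarrow> \<zeta> \<in> ball c r \<Longrightarrow> z \<noteq> \<zeta> \<Longrightarrow>
       norm (g z + (\<zeta> - b) * (g z)\<^sup>2 - 1 / (z - \<zeta>)) \<le> 2000000 * min (1 / norm (z - \<zeta>)) (r\<^sup>2 / norm (z - \<zeta>) ^ 3)"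
proof -
  obtain q where q: "q \<in> connected_component_set (ball c r - K) c" "r / 2 \<le> norm (q - c)"
    using exists_far_point_in_component[OF K conn c r] .
  obtain T where T: "T \<in> poly_approx K" "\<And>z. z \<in> K \<Longrightarrow> (T z)\<^sup>2 = (z - q) / (z - c)"
    "\<And>z. z \<in> K \<Longrightarrow> r \<le> norm (z - c) \<Longrightarrow> T z = csqrt (1 - (q - c) / (z - c))"
    using sqrt_branch[OF K conn c r q(1)] by blast
  have "q \<in> ball c r" using q(1) connected_component_subset by blast
  then have qr: "norm (q - c) < r" by (simp add: dist_norm norm_minus_commute)
  define e where "e = q - c"
  have e: "r / 2 \<le> norm e" "norm e < r" "e \<noteq> 0" using q(2) qr r by (auto simp: e_def)
  \<comment> \<open>Apart from the sign of the root this is the multiple of \<open>u - sqrt (u\<^sup>2 - (e / 2)\<^sup>2)\<close>, \<open>u = z - c - e / 2\<close>, that behaves like \<open>1 / z\<close> at infinity.\<close>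
  define g where "g = (\<lambda>z. 8 / e\<^sup>2 * ((z - c) - e / 2 - (z - c) * T z))"
  have zc: "(\<lambda>z. z - c) \<in> poly_approx K" by (rule poly_approx_diff[OF K poly_approx_id poly_approx_const])
  have g: "g \<in> poly_approx K" unfolding g_def
    by (intro poly_approx_cmult[OF _ K] poly_approx_diff[OF K] poly_approx_mult[OF K zc T(1)] zc poly_approx_const)
  have est: "norm (g z + (\<zeta> - (c + e / 2)) * (g z)\<^sup>2 - 1 / (z - \<zeta>)) \<le> 2000000 * min (1 / norm (z - \<zeta>)) (r\<^sup>2 / norm (z - \<zeta>) ^ 3)"
    if z: "z \<in> K" and zeta: "\<zeta> \<in> ball c r" and ne: "z \<noteq> \<zeta>" for z \<zeta>
  proof -
    define v where "v = z - c"
    define \<eta> where "\<eta> = \<zeta> - c"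
    define W where "W = norm (z - \<zeta>)"
    have W0: "W > 0" using ne by (simp add: W_def)
    have eta: "norm \<eta> < r" using zeta by (simp add: \<eta>_def dist_norm norm_minus_commute)
    have v0: "v \<noteq> 0" using z c by (auto simp: v_def)
    have T2: "(T z)\<^sup>2 = 1 - e / v" using T(2)[OF z] v0 by (simp add: v_def e_def divide_simps)
    have gz: "g z = 8 / e\<^sup>2 * (v - e / 2 - v * T z)" by (simp add: g_def v_def)
    have w: "z - \<zeta> = v - \<eta>" "\<zeta> - (c + e / 2) = \<eta> - e / 2" by (auto simp: v_def \<eta>_def algebra_simps)
    let ?D = "norm (g z + (\<eta> - e / 2) * (g z)\<^sup>2 - 1 / (v - \<eta>))"
    have "?D \<le> 2000000 * (1 / W) \<and> ?D \<le> 2000000 * (r\<^sup>2 / W ^ 3)"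
    proof (cases "2 * r \<le> norm v")
      case True
      have Wv: "W \<le> 3/2 * norm v" "norm v / 2 \<le> W"
        using norm_triangle_ineq4[of v \<eta>] norm_triangle_ineq2[of v \<eta>] eta True w by (auto simp: W_def)
      have "T z = csqrt (1 - e / v)" using T(3)[OF z] True r by (simp add: e_def v_def)
      then have Re: "Re (T z) \<ge> 0" using Re_csqrt by metis
      have D: "?D \<le> 46 * r\<^sup>2 / norm v ^ 3" unfolding gz
        by (rule sqrt_kernel_expansion[OF T2 Re r e(2) eta True e(3)])
      also have "\<dots> \<le> 46 * r\<^sup>2 / (W / (3/2)) ^ 3" using Wv W0 v0
        by (intro divide_left_mono power_mono mult_pos_pos) auto
      also have "\<dots> = (46 * 27 / 8) * (r\<^sup>2 / W ^ 3)" by (simp add: power3_eq_cube)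
      also have "\<dots> \<le> 2000000 * (r\<^sup>2 / W ^ 3)" using W0 by (intro mult_right_mono) auto
      finally have 1: "?D \<le> 2000000 * (r\<^sup>2 / W ^ 3)" .
      have "r \<le> W" using Wv True by simp
      then have "r\<^sup>2 / W ^ 3 \<le> W\<^sup>2 / W ^ 3" using r W0 by (intro divide_right_mono power_mono) auto
      also have "\<dots> = 1 / W" using W0 by (simp add: power2_eq_square power3_eq_cube)
      finally have "r\<^sup>2 / W ^ 3 \<le> 1 / W" .
      with 1 show ?thesis by linarith
    next
      case False
      have W3: "W \<le> 3 * r" using norm_triangle_ineq4[of v \<eta>] eta False w by (auto simp: W_def)
      have "norm (v * T z) ^ 2 = norm (v * (v - e))"
      proof -
        have "(v * T z)^2 = v * (v * (1 - e / v))" unfolding power_mult_distrib T2 by (simp add: power2_eq_square)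
        also have "v * (1 - e / v) = v - e" using v0 by (simp add: right_diff_distrib)
        finally have "(v * T z)^2 = v * (v - e)" .
        then show ?thesis by (metis norm_power)
      qed
      also have "\<dots> \<le> (2 * r) * (3 * r)" unfolding norm_mult
        using False e norm_triangle_ineq4[of v e] r by (intro mult_mono) auto
      also have "\<dots> \<le> (3 * r) ^ 2" using r by (simp add: power2_eq_square)
      finally have "norm (v * T z) ^ 2 \<le> (3 * r) ^ 2" .
      then have vT: "norm (v * T z) \<le> 3 * r" by (rule power2_le_imp_le) (use r in simp)
      have "norm (v - e / 2 - v * T z) \<le> norm v + norm (e / 2) + norm (v * T z)"
        using norm_triangle_ineq4[of "v - e / 2" "v * T z"] norm_triangle_ineq4[of v "e / 2"] by linarith
      also have "\<dots> \<le> 2 * r + r / 2 + 3 * r" using vT False e by (intro add_mono) (auto simp: norm_divide)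
      finally have A: "norm (v - e / 2 - v * T z) \<le> 11/2 * r" by simp
      have "norm (8 / e\<^sup>2) \<le> 8 / (r / 2)\<^sup>2" unfolding norm_divide norm_power
        using e r by (intro frac_le power_mono) auto
      then have "norm (8 / e\<^sup>2) \<le> 32 / r\<^sup>2" by (simp add: power2_eq_square)
      then have "norm (g z) \<le> (32 / r\<^sup>2) * (11/2 * r)" unfolding gz norm_mult using A by (intro mult_mono) auto
      also have "\<dots> = 176 / r" using r by (simp add: power2_eq_square)
      finally have G: "norm (g z) \<le> 176 / r" .
      have "norm (\<eta> - e / 2) \<le> 3/2 * r" using norm_triangle_ineq4[of \<eta> "e / 2"] eta e by (simp add: norm_divide)
      then have "norm ((\<eta> - e / 2) * (g z)\<^sup>2) \<le> (3/2 * r) * (176 / r)\<^sup>2"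
        unfolding norm_mult norm_power using G r by (intro mult_mono power_mono) auto
      also have "\<dots> = 46464 / r" using r by (simp add: power2_eq_square)
      finally have "?D \<le> 176 / r + 46464 / r + 1 / W"
        using G norm_triangle_ineq4[of "g z + (\<eta> - e / 2) * (g z)\<^sup>2" "1 / (v - \<eta>)"]
          norm_triangle_ineq[of "g z" "(\<eta> - e / 2) * (g z)\<^sup>2"] by (simp add: W_def w norm_divide)
      also have "\<dots> = 46640 * (1 / r) + 1 / W" by simp
      also have "\<dots> \<le> 46640 * (3 / W) + 1 / W" using W3 W0 r by (intro add_mono mult_left_mono) (auto simp: divide_simps)
      finally have 1: "?D \<le> 139921 * (1 / W)" by simp
      have "1 / W \<le> 9 * (r\<^sup>2 / W ^ 3)"
      proof -
        have "1 / W = W\<^sup>2 / W ^ 3" using W0 by (simp add: power2_eq_square power3_eq_cube)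
        also have "\<dots> \<le> (3 * r)\<^sup>2 / W ^ 3" using W3 W0 by (intro divide_right_mono power_mono) auto
        finally show ?thesis by (simp add: power_mult_distrib)
      qed
      moreover have "0 \<le> 1 / W" "0 \<le> r\<^sup>2 / W ^ 3" using W0 by auto
      ultimately show ?thesis using 1 by linarith
    qed
    then show ?thesis by (auto simp: w W_def)
  qed
  show ?thesis using that[OF g est] by blast
qed

section \<open>Planar integrals of the Cauchy kernel\<close>

definition kernel_majorant :: "real \<Rightarrow> complex \<Rightarrow> real" where
  "kernel_majorant r v = min (1 / norm v) (r\<^sup>2 / norm v ^ 3)"

lemma kernel_majorant_nonneg: "0 \<le> kernel_majorant r v"
  by (simp add: kernel_majorant_def)

lemma kernel_majorant_measurable [measurable]: "kernel_majorant r \<in> borel_measurable borel"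
  unfolding kernel_majorant_def by measurable

lemma dyadic_bracket:
  fixes x :: real
  assumes "1 \<le> x"
  obtains k where "2 ^ k \<le> x" "x < 2 ^ Suc k"
proof -
  obtain n where n: "x < 2 ^ n" using real_arch_pow[of 2 x] by auto
  define m where "m = (LEAST n. x < 2 ^ n)"
  have m: "x < 2 ^ m" unfolding m_def using n by (rule LeastI)
  have "m \<noteq> 0" using m assms by (intro notI) simp
  then obtain k where k: "m = Suc k" using not0_implies_Suc by blast
  have "\<not> x < 2 ^ k" using not_less_Least[of k "\<lambda>n. x < 2 ^ n"] k unfolding m_def by simp
  then show ?thesis using that[of k] m k by simp
qed

lemma emeasure_cball_complex:
  assumes "0 \<le> r"
  shows "emeasure lborel (cball (c::complex) r) = ennreal (pi * r\<^sup>2)"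
  using emeasure_cball[OF assms, of c] by (simp add: eval_unit_ball_vol)

lemma measure_ball_complex:
  assumes "0 \<le> r"
  shows "measure lborel (ball (c::complex) r) = pi * r\<^sup>2"
  using content_ball[OF assms, of c] by (simp add: eval_unit_ball_vol)

text \<open>
  The majorant is dominated by a series of multiples of indicators of the discs of radius
  \<open>r / 2 ^ k\<close> and \<open>2 ^ Suc k * r\<close>, whose integrals form a geometric series.
\<close>

lemma nn_integral_kernel_majorant_zero:
  assumes r: "r > 0"
  shows "(\<integral>\<^sup>+v. ennreal (kernel_majorant r v) \<partial>lborel) \<le> ennreal (12 * pi * r)"
proof -
  define a where "a = (\<lambda>k::nat. 2 ^ Suc k / r)"
  define b where "b = (\<lambda>k::nat. 1 / (8 ^ k * r))"
  define A where "A = (\<lambda>k::nat. cball (0::complex) (r / 2 ^ k))"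
  define B where "B = (\<lambda>k::nat. cball (0::complex) (2 ^ Suc k * r))"
  have eight_power: "(8::real) ^ k = (2 ^ k) ^ 3" for k
    using power_mult[of "2::real" 3 k] power_mult[of "2::real" k 3] by (simp add: mult.commute)
  have a0: "a k \<ge> 0" and b0: "b k \<ge> 0" for k using r by (auto simp: a_def b_def)
  have [measurable, simp]: "A k \<in> sets borel" "B k \<in> sets borel" for k by (auto simp: A_def B_def)
  define f where "f = (\<lambda>k v. ennreal (a k) * indicator (A k) v + ennreal (b k) * indicator (B k) v)"
  have pt: "ennreal (kernel_majorant r v) \<le> (\<Sum>k. f k v)" for v
  proof -
    have *: "ennreal (kernel_majorant r v) \<le> (\<Sum>k. f k v)" if "ennreal (kernel_majorant r v) \<le> f k v" for k
      using that sum_le_suminf[of "\<lambda>k. f k v" "{k}"] by (auto intro: order_trans)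
    consider "v = 0" | "v \<noteq> 0" "norm v \<le> r" | "r < norm v" by linarith
    then show ?thesis
    proof cases
      case 1
      then show ?thesis by (simp add: kernel_majorant_def)
    next
      case 2
      then obtain k where k: "2 ^ k \<le> r / norm v" "r / norm v < 2 ^ Suc k"
        using dyadic_bracket[of "r / norm v"] r by auto
      have "v \<in> A k" using k(1) 2 by (simp add: A_def field_simps)
      moreover have "1 / norm v \<le> a k" using k(2) 2 r by (simp add: a_def field_simps)
      ultimately have "ennreal (kernel_majorant r v) \<le> f k v"
        by (auto simp: f_def kernel_majorant_def intro!: add_increasing2 ennreal_leI)
      then show ?thesis by (rule *)
    next
      case 3
      then obtain k where k: "2 ^ k \<le> norm v / r" "norm v / r < 2 ^ Suc k"
        using dyadic_bracket[of "norm v / r"] r by auto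
      have k1: "2 ^ k * r \<le> norm v" using k(1) r by (simp add: field_simps)
      have "v \<in> B k" using k(2) r by (simp add: B_def field_simps)
      moreover have "r\<^sup>2 / norm v ^ 3 \<le> b k"
      proof -
        have "r\<^sup>2 / norm v ^ 3 \<le> r\<^sup>2 / (2 ^ k * r) ^ 3"
          using k1 r 3 by (intro divide_left_mono power_mono mult_pos_pos zero_less_power) auto
        also have "(2 ^ k * r) ^ 3 = 8 ^ k * r * r\<^sup>2"
          unfolding eight_power by (simp add: power_mult_distrib power2_eq_square power3_eq_cube)
        also have "r\<^sup>2 / (8 ^ k * r * r\<^sup>2) = b k" using r by (simp add: b_def)
        finally show ?thesis .
      qed
      ultimately have "ennreal (kernel_majorant r v) \<le> f k v"
        by (auto simp: f_def kernel_majorant_def intro!: add_increasing ennreal_leI)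
      then show ?thesis by (rule *)
    qed
  qed
  have int: "(\<integral>\<^sup>+v. f k v \<partial>lborel) = ennreal (6 * pi * r * (1/2) ^ k)" for k
  proof -
    have "(\<integral>\<^sup>+v. f k v \<partial>lborel) = ennreal (a k) * emeasure lborel (A k) + ennreal (b k) * emeasure lborel (B k)"
      unfolding f_def by (subst nn_integral_add) (auto simp: nn_integral_cmult_indicator)
    also have "emeasure lborel (A k) = ennreal (pi * (r / 2 ^ k)\<^sup>2)"
      unfolding A_def by (rule emeasure_cball_complex) (use r in auto)
    also have "emeasure lborel (B k) = ennreal (pi * (2 ^ Suc k * r)\<^sup>2)"
      unfolding B_def by (rule emeasure_cball_complex) (use r in auto)
    also have "ennreal (a k) * ennreal (pi * (r / 2 ^ k)\<^sup>2) + ennreal (b k) * ennreal (pi * (2 ^ Suc k * r)\<^sup>2)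
       = ennreal (a k * (pi * (r / 2 ^ k)\<^sup>2) + b k * (pi * (2 ^ Suc k * r)\<^sup>2))"
      using a0 b0 by (simp add: ennreal_mult[symmetric] ennreal_plus[symmetric] del: ennreal_plus)
    also have "a k * (pi * (r / 2 ^ k)\<^sup>2) + b k * (pi * (2 ^ Suc k * r)\<^sup>2) = 6 * pi * r * (1/2) ^ k"
    proof -
      define x :: real where "x = 2 ^ k"
      have "x > 0" and e: "(8::real) ^ k = x ^ 3" "(1/2::real) ^ k = 1 / x"
        by (auto simp: x_def power_one_over eight_power)
      then show ?thesis unfolding a_def b_def e power_Suc x_def[symmetric]
        using r by (simp add: field_simps power2_eq_square power3_eq_cube)
    qed
    finally show ?thesis .
  qed
  have "(\<integral>\<^sup>+v. ennreal (kernel_majorant r v) \<partial>lborel) \<le> (\<integral>\<^sup>+v. (\<Sum>k. f k v) \<partial>lborel)"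
    by (intro nn_integral_mono pt)
  also have "\<dots> = (\<Sum>k. (\<integral>\<^sup>+v. f k v \<partial>lborel))"
    by (rule nn_integral_suminf) (auto simp: f_def)
  also have "\<dots> = (\<Sum>k. ennreal (6 * pi * r * (1/2) ^ k))" by (simp add: int)
  also have "\<dots> = ennreal (12 * pi * r)"
  proof (rule suminf_ennreal_eq)
    have "(\<lambda>k. (1/2::real) ^ k) sums 2" using geometric_sums[of "1/2::real"] by simp
    then have "(\<lambda>k. 6 * pi * r * (1/2) ^ k) sums (6 * pi * r * 2)" by (rule sums_mult)
    moreover have "6 * pi * r * 2 = 12 * pi * r" by simp
    ultimately show "(\<lambda>k. 6 * pi * r * (1/2) ^ k) sums (12 * pi * r)" by (simp only:)
  qed (use r in auto)
  finally show ?thesis .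
qed

lemma nn_integral_kernel_majorant:
  assumes r: "r > 0"
  shows "(\<integral>\<^sup>+\<zeta>. ennreal (kernel_majorant r (z - \<zeta>)) \<partial>lborel) \<le> ennreal (12 * pi * r)"
proof -
  have "(\<integral>\<^sup>+v. ennreal (kernel_majorant r v) \<partial>lborel)
      = (\<integral>\<^sup>+v. ennreal (kernel_majorant r v) \<partial>distr lborel borel ((+) (- z)))"
    by (simp only: lborel_distr_plus)
  also have "\<dots> = (\<integral>\<^sup>+\<zeta>. ennreal (kernel_majorant r (- z + \<zeta>)) \<partial>lborel)"
    by (rule nn_integral_distr) auto
  also have "(\<lambda>\<zeta>. kernel_majorant r (- z + \<zeta>)) = (\<lambda>\<zeta>. kernel_majorant r (z - \<zeta>))"
    by (simp add: kernel_majorant_def norm_minus_commute)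
  finally show ?thesis using nn_integral_kernel_majorant_zero[OF r] by simp
qed

text \<open>
  The bound is uniform in \<open>z\<close>; this makes the double integrals below absolutely convergent.
\<close>

lemma nn_integral_cauchy_kernel:
  fixes \<phi> :: "complex \<Rightarrow> complex"
  assumes M: "M \<ge> 0" "R \<ge> 0" "\<And>\<zeta>. norm (\<phi> \<zeta>) \<le> M" "\<And>\<zeta>. R < norm \<zeta> \<Longrightarrow> \<phi> \<zeta> = 0"
  shows "(\<integral>\<^sup>+\<zeta>. ennreal (norm (\<phi> \<zeta> / (z - \<zeta>))) \<partial>lborel) \<le> ennreal (M * (12 * pi + pi * R\<^sup>2))"
proof -
  have "ennreal (norm (\<phi> \<zeta> / (z - \<zeta>))) \<le>
     ennreal M * (ennreal (kernel_majorant 1 (z - \<zeta>)) + indicator (cball 0 R) \<zeta>)" for \<zeta>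
  proof (cases "norm \<zeta> \<le> R")
    case False
    then show ?thesis using M(4) by simp
  next
    case True
    have "1 / norm (z - \<zeta>) \<le> kernel_majorant 1 (z - \<zeta>) + 1"
    proof (cases "norm (z - \<zeta>) \<le> 1 \<and> z \<noteq> \<zeta>")
      case True
      have "norm (z - \<zeta>) ^ 3 \<le> norm (z - \<zeta>)"
        using True power_decreasing[of 1 3 "norm (z - \<zeta>)"] by simp
      then have "1 / norm (z - \<zeta>) \<le> 1 / norm (z - \<zeta>) ^ 3"
        using True by (intro divide_left_mono) auto
      then show ?thesis by (simp add: kernel_majorant_def)
    next
      case False
      then have "1 / norm (z - \<zeta>) \<le> 1" by (cases "z = \<zeta>") (auto simp: divide_simps)
      then show ?thesis using kernel_majorant_nonneg[of 1 "z - \<zeta>"] by linarith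
    qed
    then have "norm (\<phi> \<zeta>) * (1 / norm (z - \<zeta>)) \<le> M * (kernel_majorant 1 (z - \<zeta>) + 1)"
      using M by (intro mult_mono) auto
    then have "ennreal (norm (\<phi> \<zeta> / (z - \<zeta>))) \<le> ennreal (M * (kernel_majorant 1 (z - \<zeta>) + 1))"
      by (intro ennreal_leI) (simp add: norm_divide)
    also have "\<dots> = ennreal M * (ennreal (kernel_majorant 1 (z - \<zeta>)) + 1)"
      using M(1) kernel_majorant_nonneg[of 1 "z - \<zeta>"] by (simp add: ennreal_mult)
    finally show ?thesis using True by simp
  qed
  then have "(\<integral>\<^sup>+\<zeta>. ennreal (norm (\<phi> \<zeta> / (z - \<zeta>))) \<partial>lborel) \<le>
     (\<integral>\<^sup>+\<zeta>. ennreal M * (ennreal (kernel_majorant 1 (z - \<zeta>)) + indicator (cball 0 R) \<zeta>) \<partial>lborel)"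
    by (intro nn_integral_mono)
  also have "\<dots> = ennreal M * ((\<integral>\<^sup>+\<zeta>. ennreal (kernel_majorant 1 (z - \<zeta>)) \<partial>lborel) + emeasure lborel (cball (0::complex) R))"
  proof -
    have 1: "(\<lambda>\<zeta>. ennreal (kernel_majorant 1 (z - \<zeta>))) \<in> borel_measurable lborel" by measurable
    have 2: "(indicator (cball 0 R) :: complex \<Rightarrow> ennreal) \<in> borel_measurable lborel"
      by (rule borel_measurable_indicator) simp
    show ?thesis using borel_measurable_add[OF 1 2] nn_integral_add[OF 1 2] by (simp add: nn_integral_cmult)
  qed
  also have "\<dots> \<le> ennreal M * (ennreal (12 * pi * 1) + ennreal (pi * R\<^sup>2))"
    using M by (intro mult_left_mono add_mono nn_integral_kernel_majorant) (auto simp: emeasure_cball_complex)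
  also have "\<dots> = ennreal (M * (12 * pi + pi * R\<^sup>2))"
    using M by (simp add: ennreal_mult)
  finally show ?thesis .
qed

section \<open>Disc averages as Cauchy transforms\<close>

definition circle_point :: "real \<Rightarrow> real \<Rightarrow> complex" where
  "circle_point \<delta> t = of_real \<delta> * exp (2 * of_real pi * \<i> * of_real t)"

lemma norm_circle_point [simp]: "norm (circle_point \<delta> t) = \<bar>\<delta>\<bar>"
  by (simp add: circle_point_def norm_mult norm_exp_eq_Re)

lemma continuous_circle_point [continuous_intros]: "continuous_on S (circle_point \<delta>)"
  unfolding circle_point_def by (intro continuous_intros)

lemma circle_point_measurable [measurable]: "circle_point \<delta> \<in> borel_measurable borel"
  by (intro borel_measurable_continuous_onI continuous_intros)

lemma contour_integral_circle_Lebesgue: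
  assumes \<delta>: "\<delta> > 0" and f: "continuous_on (sphere z \<delta>) f"
  shows "contour_integral (circlepath z \<delta>) f =
    2 * of_real pi * \<i> * (LINT t|lborel. indicator {0..1} t *\<^sub>R (f (z + circle_point \<delta> t) * circle_point \<delta> t))"
proof -
  have c: "continuous_on {0..1} (\<lambda>t. f (z + circle_point \<delta> t) * circle_point \<delta> t)"
    by (intro continuous_intros continuous_on_compose2[OF f]) (use \<delta> in \<open>auto simp: dist_norm\<close>)
  have "contour_integral (circlepath z \<delta>) f =
     integral {0..1} (\<lambda>t. 2 * of_real pi * \<i> * (f (z + circle_point \<delta> t) * circle_point \<delta> t))"
    unfolding contour_integral_integral vector_derivative_circlepath
    by (intro integral_cong) (simp add: circlepath circle_point_def)
  also have "\<dots> = 2 * of_real pi * \<i> * integral {0..1} (\<lambda>t. f (z + circle_point \<delta> t) * circle_point \<delta> t)"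
    by simp
  also have "integral {0..1} (\<lambda>t. f (z + circle_point \<delta> t) * circle_point \<delta> t)
     = (LINT t:{0..1}|lborel. f (z + circle_point \<delta> t) * circle_point \<delta> t)"
    by (rule set_borel_integral_eq_integral(2)[symmetric]) (rule borel_integrable_atLeastAtMost'[OF c])
  finally show ?thesis by (simp add: set_lebesgue_integral_def)
qed

lemma circle_winding_integral:
  assumes \<delta>: "\<delta> > 0" and u: "norm u \<noteq> \<delta>"
  shows "(LINT t|lborel. indicator {0..1} t *\<^sub>R (circle_point \<delta> t / (circle_point \<delta> t - u))) =
    (if norm u < \<delta> then 1 else 0)"
proof -
  have c: "continuous_on (sphere 0 \<delta>) (\<lambda>w. 1 / (w - u))"
    using u by (intro continuous_intros) auto
  have "u \<notin> path_image (circlepath 0 \<delta>)" using u \<delta> by simp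
  then have "winding_number (circlepath 0 \<delta>) u = 1 / (2 * of_real pi * \<i>) * contour_integral (circlepath 0 \<delta>) (\<lambda>w. 1 / (w - u))"
    by (simp add: winding_number_valid_path)
  also have "\<dots> = (LINT t|lborel. indicator {0..1} t *\<^sub>R (circle_point \<delta> t / (circle_point \<delta> t - u)))"
    unfolding contour_integral_circle_Lebesgue[OF \<delta> c] by simp
  finally have "(LINT t|lborel. indicator {0..1} t *\<^sub>R (circle_point \<delta> t / (circle_point \<delta> t - u))) = winding_number (circlepath 0 \<delta>) u" ..
  also have "\<dots> = (if norm u < \<delta> then 1 else 0)"
  proof (cases "norm u < \<delta>")
    case True
    then show ?thesis using winding_number_circlepath[of u 0 \<delta>] by simp
  next
    case False
    then show ?thesis using winding_number_zero_outside[of "circlepath 0 \<delta>" "cball 0 \<delta>" u] u \<delta>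
      by (auto simp: valid_path_imp_path)
  qed
  finally show ?thesis .
qed

text \<open>
  Up to the factor \<open>1 / (2 * pi * \<i> * (pi * \<delta>\<^sup>2))\<close> this is the contour integral of \<open>f\<close> over the circle of radius \<open>\<delta>\<close>
  about \<open>\<zeta>\<close>. Writing it as a Lebesgue integral over the unit interval makes Fubini's theorem applicable.
  It is \<open>1 / pi\<close> times the d-bar derivative of the average of \<open>f\<close> over \<open>ball \<zeta> \<delta>\<close>.
\<close>

definition cauchy_density :: "(complex \<Rightarrow> complex) \<Rightarrow> real \<Rightarrow> complex \<Rightarrow> complex" where
  "cauchy_density f \<delta> \<zeta> = (1 / (of_real pi * of_real \<delta> ^ 2)) *
     (LINT t|lborel. indicator {0..1} t *\<^sub>R (f (\<zeta> + circle_point \<delta> t) * circle_point \<delta> t))"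

lemma cauchy_density_contour:
  assumes "\<delta> > 0" "continuous_on UNIV f"
  shows "cauchy_density f \<delta> \<zeta> = contour_integral (circlepath \<zeta> \<delta>) f / (2 * of_real pi * \<i> * (of_real pi * of_real \<delta> ^ 2))"
  unfolding cauchy_density_def
  by (subst contour_integral_circle_Lebesgue) (use assms continuous_on_subset in auto)

text \<open>
  Constants have zero integral over a circle, so \<open>f\<close> may be replaced by \<open>f - f \<zeta>\<close>.
\<close>

lemma cauchy_density_bound:
  assumes \<delta>: "\<delta> > 0" and f: "continuous_on UNIV f" and \<omega>: "\<omega> \<ge> 0"
    and osc: "\<And>w. norm (w - \<zeta>) = \<delta> \<Longrightarrow> norm (f w - f \<zeta>) \<le> \<omega>"
  shows "norm (cauchy_density f \<delta> \<zeta>) \<le> \<omega> / (pi * \<delta>)"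
proof -
  have sub: "sphere \<zeta> \<delta> \<subseteq> ball \<zeta> (\<delta> + 1)" by auto
  have ci: "f contour_integrable_on circlepath \<zeta> \<delta>"
    by (intro contour_integrable_continuous_circlepath continuous_on_subset[OF f]) auto
  have "((\<lambda>w. f w - f \<zeta>) has_contour_integral contour_integral (circlepath \<zeta> \<delta>) f - 0) (circlepath \<zeta> \<delta>)"
  proof (rule has_contour_integral_diff)
    show "(f has_contour_integral contour_integral (circlepath \<zeta> \<delta>) f) (circlepath \<zeta> \<delta>)"
      using ci by (rule has_contour_integral_integral)
    show "((\<lambda>w. f \<zeta>) has_contour_integral 0) (circlepath \<zeta> \<delta>)"
      using sub Cauchy_theorem_disc_simple[of "\<lambda>w. f \<zeta>" \<zeta> "\<delta> + 1" "circlepath \<zeta> \<delta>"] \<delta> by auto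
  qed
  then have "norm (contour_integral (circlepath \<zeta> \<delta>) f - 0) \<le> \<omega> * (2 * pi * \<delta>)"
    by (rule has_contour_integral_bound_circlepath[OF _ \<omega> \<delta>]) (rule osc)
  then have "norm (contour_integral (circlepath \<zeta> \<delta>) f) / (2 * pi * (pi * \<delta>\<^sup>2)) \<le> \<omega> * (2 * pi * \<delta>) / (2 * pi * (pi * \<delta>\<^sup>2))"
    using \<delta> by (intro divide_right_mono) auto
  also have "\<dots> = \<omega> / (pi * \<delta>)" using \<delta> by (simp add: power2_eq_square)
  finally show ?thesis unfolding cauchy_density_contour[OF \<delta> f]
    by (simp add: norm_divide norm_mult norm_power)
qed

lemma cauchy_density_holomorphic_zero:
  assumes \<delta>: "\<delta> > 0" and f: "continuous_on UNIV f" and hol: "f holomorphic_on ball \<zeta> \<delta>"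
  shows "cauchy_density f \<delta> \<zeta> = 0"
proof -
  have "(f has_contour_integral 0) (circlepath \<zeta> \<delta>)"
  proof (rule Cauchy_theorem_convex[where S = "cball \<zeta> \<delta>" and K = "{}"])
    show "f field_differentiable at x" if "x \<in> interior (cball \<zeta> \<delta>) - {}" for x
      using hol that by (auto simp: holomorphic_on_def) (metis at_within_open centre_in_ball mem_ball open_ball)
  qed (use \<delta> f continuous_on_subset in auto)
  then show ?thesis unfolding cauchy_density_contour[OF \<delta> f] by (simp add: contour_integral_unique)
qed

lemma cauchy_density_far_zero:
  assumes "\<delta> > 0" "\<And>z. R < norm z \<Longrightarrow> f z = 0" "R + \<delta> < norm \<zeta>"
  shows "cauchy_density f \<delta> \<zeta> = 0"
proof -
  have "f (\<zeta> + circle_point \<delta> t) = 0" for t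
    using norm_triangle_ineq2[of \<zeta> "- circle_point \<delta> t"] assms by (intro assms(2)) simp
  then show ?thesis by (simp add: cauchy_density_def)
qed

lemma cauchy_density_measurable [measurable]:
  assumes "continuous_on UNIV f"
  shows "cauchy_density f \<delta> \<in> borel_measurable borel"
proof -
  have [measurable]: "f \<in> borel_measurable borel" using assms by (rule borel_measurable_continuous_onI)
  have "(\<lambda>\<zeta>. LINT t|lborel. indicator {0..1} t *\<^sub>R (f (\<zeta> + circle_point \<delta> t) * circle_point \<delta> t)) \<in> borel_measurable borel"
    by (rule lborel.borel_measurable_lebesgue_integral) measurable
  then show ?thesis unfolding cauchy_density_def by measurable
qed

lemma integrable_unit_interval_product:
  fixes h :: "real \<Rightarrow> complex \<Rightarrow> complex"
  assumes [measurable]: "case_prod h \<in> borel_measurable (lborel \<Otimes>\<^sub>M lborel)"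
    and bound: "\<And>t. t \<in> {0..1} \<Longrightarrow> (\<integral>\<^sup>+\<zeta>. ennreal (norm (h t \<zeta>)) \<partial>lborel) \<le> ennreal C"
    and zero: "\<And>t \<zeta>. t \<notin> {0..1} \<Longrightarrow> h t \<zeta> = 0"
  shows "integrable (lborel \<Otimes>\<^sub>M lborel) (case_prod h)"
proof (rule integrableI_bounded)
  have "(\<integral>\<^sup>+x. ennreal (norm (case_prod h x)) \<partial>(lborel \<Otimes>\<^sub>M lborel))
     = (\<integral>\<^sup>+t. (\<integral>\<^sup>+\<zeta>. ennreal (norm (h t \<zeta>)) \<partial>lborel) \<partial>lborel)"
    by (subst lborel.nn_integral_fst[symmetric]) auto
  also have "\<dots> \<le> (\<integral>\<^sup>+(t::real). ennreal C * indicator {0..1} t \<partial>lborel)"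
  proof (intro nn_integral_mono)
    fix t :: real
    show "(\<integral>\<^sup>+\<zeta>. ennreal (norm (h t \<zeta>)) \<partial>lborel) \<le> ennreal C * indicator {0..1} t"
      using bound[of t] zero[of t] by (cases "t \<in> {0..1}") auto
  qed
  also have "\<dots> = ennreal C" by (simp add: nn_integral_cmult_indicator)
  also have "\<dots> < \<infinity>" by simp
  finally show "(\<integral>\<^sup>+x. ennreal (norm (case_prod h x)) \<partial>(lborel \<Otimes>\<^sub>M lborel)) < \<infinity>" .
qed fact

lemma lborel_integral_translate:
  fixes g :: "complex \<Rightarrow> complex"
  assumes [measurable]: "g \<in> borel_measurable borel"
  shows "(LINT \<zeta>|lborel. g (c + \<zeta>)) = (LINT w|lborel. g w)"
proof -
  have "(LINT w|lborel. g w) = (LINT w|distr lborel borel ((+) c). g w)" by (simp only: lborel_distr_plus)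
  also have "\<dots> = (LINT \<zeta>|lborel. g (c + \<zeta>))" by (rule integral_distr) auto
  finally show ?thesis ..
qed

text \<open>
  After Fubini and the substitution \<open>w = \<zeta> + \<tau>\<close>, with \<open>\<tau>\<close> on the circle of radius \<open>\<delta>\<close>, the inner integral over the
  circle is the winding number about \<open>w - z\<close>, which is the indicator of \<open>ball z \<delta>\<close> at almost every \<open>w\<close>.
  So averages over discs are represented as Cauchy transforms although \<open>f\<close> is merely continuous.
\<close>

lemma cauchy_transform_density:
  fixes f :: "complex \<Rightarrow> complex"
  assumes \<delta>: "\<delta> > 0" and cf: "continuous_on UNIV f" and M: "\<And>z. norm (f z) \<le> M"
    and R: "R \<ge> 0" "\<And>z. R < norm z \<Longrightarrow> f z = 0"
  shows "(LINT \<zeta>|lborel. cauchy_density f \<delta> \<zeta> / (z - \<zeta>)) =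
     (1 / (of_real pi * of_real \<delta> ^ 2)) * (LINT w|lborel. indicator (ball z \<delta>) w *\<^sub>R f w)"
proof -
  define c where "c = (1 / (of_real pi * of_real \<delta> ^ 2) :: complex)"
  have M0: "M \<ge> 0" using M[of 0] norm_ge_zero order_trans by blast
  have [measurable]: "f \<in> borel_measurable borel" using cf by (rule borel_measurable_continuous_onI)
  define h where "h = (\<lambda>t \<zeta>. indicator {0..1} t *\<^sub>R (f (\<zeta> + circle_point \<delta> t) * circle_point \<delta> t) / (z - \<zeta>))"
  define h' where "h' = (\<lambda>t w. indicator {0..1} t *\<^sub>R (f w * circle_point \<delta> t) / (z - w + circle_point \<delta> t))"
  have [measurable]: "case_prod h \<in> borel_measurable (lborel \<Otimes>\<^sub>M lborel)"
    "case_prod h' \<in> borel_measurable (lborel \<Otimes>\<^sub>M lborel)" unfolding h_def h'_def by measurable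
  have ih: "integrable (lborel \<Otimes>\<^sub>M lborel) (case_prod h)"
  proof (rule integrable_unit_interval_product)
    fix t :: real assume "t \<in> {0..1}"
    have "(\<integral>\<^sup>+\<zeta>. ennreal (norm ((f (\<zeta> + circle_point \<delta> t) * circle_point \<delta> t) / (z - \<zeta>))) \<partial>lborel)
       \<le> ennreal ((M * \<delta>) * (12 * pi + pi * (R + \<delta>)\<^sup>2))"
    proof (rule nn_integral_cauchy_kernel)
      show "norm (f (\<zeta> + circle_point \<delta> t) * circle_point \<delta> t) \<le> M * \<delta>" for \<zeta>
        using M[of "\<zeta> + circle_point \<delta> t"] \<delta> by (simp add: norm_mult)
      show "f (\<zeta> + circle_point \<delta> t) * circle_point \<delta> t = 0" if "R + \<delta> < norm \<zeta>" for \<zeta>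
        using norm_triangle_ineq2[of \<zeta> "- circle_point \<delta> t"] that \<delta> by (simp add: R(2))
    qed (use M0 \<delta> R in auto)
    then show "(\<integral>\<^sup>+\<zeta>. ennreal (norm (h t \<zeta>)) \<partial>lborel) \<le> ennreal ((M * \<delta>) * (12 * pi + pi * (R + \<delta>)\<^sup>2))"
      using \<open>t \<in> {0..1}\<close> by (simp add: h_def)
  qed (auto simp: h_def)
  have ih': "integrable (lborel \<Otimes>\<^sub>M lborel) (case_prod h')"
  proof (rule integrable_unit_interval_product)
    fix t :: real assume "t \<in> {0..1}"
    have "(\<integral>\<^sup>+w. ennreal (norm ((f w * circle_point \<delta> t) / ((z + circle_point \<delta> t) - w))) \<partial>lborel)
       \<le> ennreal ((M * \<delta>) * (12 * pi + pi * R\<^sup>2))"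
    proof (rule nn_integral_cauchy_kernel)
      show "norm (f w * circle_point \<delta> t) \<le> M * \<delta>" for w
        using M[of w] \<delta> by (simp add: norm_mult)
    qed (use M0 \<delta> R in auto)
    then show "(\<integral>\<^sup>+w. ennreal (norm (h' t w)) \<partial>lborel) \<le> ennreal ((M * \<delta>) * (12 * pi + pi * R\<^sup>2))"
      using \<open>t \<in> {0..1}\<close> by (simp add: h'_def algebra_simps)
  qed (auto simp: h'_def)
  have "(LINT \<zeta>|lborel. cauchy_density f \<delta> \<zeta> / (z - \<zeta>)) = (LINT \<zeta>|lborel. c * (LINT t|lborel. h t \<zeta>))"
  proof (rule Bochner_Integration.integral_cong[OF refl])
    fix \<zeta>
    show "cauchy_density f \<delta> \<zeta> / (z - \<zeta>) = c * (LINT t|lborel. h t \<zeta>)"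
      unfolding h_def cauchy_density_def c_def by simp
  qed
  also have "\<dots> = c * (LINT \<zeta>|lborel. LINT t|lborel. h t \<zeta>)" by simp
  also have "(LINT \<zeta>|lborel. LINT t|lborel. h t \<zeta>) = (LINT t|lborel. LINT \<zeta>|lborel. h t \<zeta>)"
    by (rule lborel_pair.Fubini_integral[OF ih])
  also have "\<dots> = (LINT t|lborel. LINT w|lborel. h' t w)"
  proof (rule Bochner_Integration.integral_cong[OF refl])
    fix t :: real
    have [measurable]: "h' t \<in> borel_measurable borel" unfolding h'_def by measurable
    have "(LINT \<zeta>|lborel. h t \<zeta>) = (LINT \<zeta>|lborel. h' t (circle_point \<delta> t + \<zeta>))"
      by (simp add: h_def h'_def add.commute)
    then show "(LINT \<zeta>|lborel. h t \<zeta>) = (LINT w|lborel. h' t w)" by (simp add: lborel_integral_translate)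
  qed
  also have "\<dots> = (LINT w|lborel. LINT t|lborel. h' t w)"
    by (rule lborel_pair.Fubini_integral[OF ih', symmetric])
  also have "\<dots> = (LINT w|lborel. indicator (ball z \<delta>) w *\<^sub>R f w)"
  proof (rule integral_cong_AE)
    show "(\<lambda>w. LINT t|lborel. h' t w) \<in> borel_measurable lborel"
      by (rule lborel.borel_measurable_lebesgue_integral) (simp add: h'_def, measurable)
    show "(\<lambda>w. indicator (ball z \<delta>) w *\<^sub>R f w) \<in> borel_measurable lborel"
      by (intro borel_measurable_scaleR borel_measurable_indicator) auto
    have "sphere z \<delta> \<in> null_sets lborel"
      using negligible_sphere[of z \<delta>] by (auto simp: null_sets_completion_iff negligible_iff_null_sets)
    then have "AE w in lborel. w \<notin> sphere z \<delta>" by (rule AE_not_in)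
    then show "AE w in lborel. (LINT t|lborel. h' t w) = indicator (ball z \<delta>) w *\<^sub>R f w"
    proof eventually_elim
      case (elim w)
      then have ne: "norm (w - z) \<noteq> \<delta>" by (simp add: dist_norm norm_minus_commute)
      have "(LINT t|lborel. h' t w) = (LINT t|lborel. f w * (indicator {0..1} t *\<^sub>R (circle_point \<delta> t / (circle_point \<delta> t - (w - z)))))"
        by (intro Bochner_Integration.integral_cong) (auto simp: h'_def algebra_simps split: split_indicator)
      also have "\<dots> = f w * (LINT t|lborel. indicator {0..1} t *\<^sub>R (circle_point \<delta> t / (circle_point \<delta> t - (w - z))))"
        by (rule integral_mult_right_zero)
      also have "\<dots> = f w * (if norm (w - z) < \<delta> then 1 else 0)"
        by (simp only: circle_winding_integral[OF \<delta> ne])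
      finally show ?case by (auto simp: dist_norm norm_minus_commute split: split_indicator)
    qed
  qed
  finally show ?thesis by (simp add: c_def)
qed

lemma ball_average_close:
  fixes f :: "complex \<Rightarrow> complex"
  assumes \<delta>: "\<delta> > 0" and cf: "continuous_on UNIV f"
    and osc: "\<And>w. norm (w - z) < \<delta> \<Longrightarrow> norm (f w - f z) \<le> \<omega>" and \<omega>: "\<omega> \<ge> 0"
  shows "norm ((1 / (of_real pi * of_real \<delta> ^ 2)) * (LINT w|lborel. indicator (ball z \<delta>) w *\<^sub>R f w) - f z) \<le> \<omega>"
proof -
  define A where "A = pi * \<delta>\<^sup>2"
  have A: "A > 0" using \<delta> by (simp add: A_def)
  have meas: "measure lborel (ball z \<delta>) = A" unfolding A_def by (rule measure_ball_complex) (use \<delta> in simp)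
  have [measurable]: "f \<in> borel_measurable borel" using cf by (rule borel_measurable_continuous_onI)
  have fin: "emeasure lborel (ball z \<delta>) < \<infinity>" using emeasure_bounded_finite[OF bounded_ball[of z \<delta>]] by simp
  have i1: "integrable lborel (\<lambda>w. indicator (ball z \<delta>) w *\<^sub>R (f w - f z))"
    by (rule integrableI_bounded_set_indicator[where B = \<omega>])
       (use fin osc in \<open>auto simp: dist_norm norm_minus_commute\<close>)
  have i2: "integrable lborel (\<lambda>w. indicator (ball z \<delta>) w *\<^sub>R f z)"
    by (rule integrableI_bounded_set_indicator[where B = "norm (f z)"]) (use fin in auto)
  have "(LINT w|lborel. indicator (ball z \<delta>) w *\<^sub>R f w) =
    (LINT w|lborel. indicator (ball z \<delta>) w *\<^sub>R (f w - f z) + indicator (ball z \<delta>) w *\<^sub>R f z)"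
    by (intro Bochner_Integration.integral_cong) (auto simp: algebra_simps)
  also have "\<dots> = (LINT w|lborel. indicator (ball z \<delta>) w *\<^sub>R (f w - f z)) + (LINT w|lborel. indicator (ball z \<delta>) w *\<^sub>R f z)"
    by (rule Bochner_Integration.integral_add[OF i1 i2])
  also have "(LINT w|lborel. indicator (ball z \<delta>) w *\<^sub>R f z) = of_real A * f z"
    using fin meas by (simp add: scaleR_conv_of_real)
  finally have eq: "(1 / (of_real pi * of_real \<delta> ^ 2)) * (LINT w|lborel. indicator (ball z \<delta>) w *\<^sub>R f w) - f z
     = (1 / of_real A) * (LINT w|lborel. indicator (ball z \<delta>) w *\<^sub>R (f w - f z))"
    using A \<delta> by (simp add: A_def field_simps)
  have "norm (LINT w|lborel. indicator (ball z \<delta>) w *\<^sub>R (f w - f z)) \<le> (LINT w|lborel. indicator (ball z \<delta>) w *\<^sub>R \<omega>)"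
  proof (rule Bochner_Integration.integral_norm_bound_integral[OF i1])
    show "integrable lborel (\<lambda>w. indicator (ball z \<delta>) w *\<^sub>R \<omega>)"
      by (rule integrableI_bounded_set_indicator[where B = "\<bar>\<omega>\<bar>"]) (use fin in auto)
    show "norm (indicator (ball z \<delta>) w *\<^sub>R (f w - f z)) \<le> indicator (ball z \<delta>) w *\<^sub>R \<omega>" for w
      using osc[of w] by (auto simp: dist_norm norm_minus_commute split: split_indicator)
  qed
  also have "\<dots> = A * \<omega>" using fin meas by simp
  finally show ?thesis unfolding eq using A by (simp add: norm_mult norm_divide divide_simps mult.commute)
qed

section \<open>Mergelyan's theorem\<close>

text \<open>
  Tietze's theorem, applied on the union of \<open>K\<close> and the exterior of a large disc, where the value \<open>0\<close>
  is prescribed.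
\<close>

lemma compactly_supported_extension:
  fixes g :: "complex \<Rightarrow> complex"
  assumes K: "compact K" and g: "continuous_on K g"
  obtains f R M where "continuous_on UNIV f" "\<And>z. z \<in> K \<Longrightarrow> f z = g z" "R > 0"
    "\<And>z. R < norm z \<Longrightarrow> f z = 0" "\<And>z. norm (f z) \<le> M"
proof -
  obtain B where B: "\<And>z. z \<in> K \<Longrightarrow> norm z \<le> B"
    using compact_imp_bounded[OF K] by (auto simp: bounded_iff)
  define R where "R = \<bar>B\<bar> + 1"
  have KR: "norm z < R" if "z \<in> K" for z using B[OF that] by (simp add: R_def)
  define T where "T = {z::complex. R \<le> norm z}"
  have clT: "closed T" unfolding T_def by (intro closed_Collect_le continuous_intros)
  have disj: "z \<notin> K" if "z \<in> T" for z using KR[of z] that by (auto simp: T_def)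
  have "continuous_on (K \<union> T) (\<lambda>z. if z \<in> K then g z else 0)"
    by (rule continuous_on_If) (use K compact_imp_closed clT g disj in auto)
  moreover have "closedin (top_of_set UNIV) (K \<union> T)"
    using K compact_imp_closed clT by auto
  ultimately obtain f where f: "continuous_on UNIV f" "\<And>z. z \<in> K \<union> T \<Longrightarrow> f z = (if z \<in> K then g z else 0)"
    by (rule Tietze_unbounded) auto
  have far: "f z = 0" if "R \<le> norm z" for z
    using f(2)[of z] KR[of z] that by (auto simp: T_def)
  have "compact (f ` cball 0 R)" by (intro compact_continuous_image continuous_on_subset[OF f(1)]) auto
  then obtain M where M: "\<And>z. z \<in> cball 0 R \<Longrightarrow> norm (f z) \<le> M"
    using compact_imp_bounded bounded_iff by (metis imageI)
  have "norm (f z) \<le> \<bar>M\<bar>" for z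
    using M[of z] far[of z] by (cases "norm z \<le> R") auto
  moreover have "R > 0" by (simp add: R_def)
  ultimately show ?thesis using that[of f R "\<bar>M\<bar>"] f far by auto
qed

lemma uniform_oscillation_compact_support:
  fixes f :: "complex \<Rightarrow> complex"
  assumes f: "continuous_on UNIV f" and R: "\<And>z. R < norm z \<Longrightarrow> f z = 0" and e: "e > 0"
  obtains d where "d > 0" "\<And>x y. norm (x - y) \<le> d \<Longrightarrow> norm (f x - f y) \<le> e"
proof -
  have "uniformly_continuous_on (cball 0 (R + 1)) f"
    by (intro compact_uniformly_continuous continuous_on_subset[OF f]) auto
  then obtain d where d: "d > 0" "\<And>x y. \<lbrakk>x \<in> cball 0 (R + 1); y \<in> cball 0 (R + 1); dist y x < d\<rbrakk> \<Longrightarrow> dist (f y) (f x) < e"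
    using e unfolding uniformly_continuous_on_def by meson
  have "norm (f x - f y) \<le> e" if xy: "norm (x - y) \<le> min 1 (d / 2)" for x y
  proof (cases "norm x \<le> R + 1 \<and> norm y \<le> R + 1")
    case True
    then show ?thesis using d(2)[of y x] d(1) xy by (auto simp: dist_norm)
  next
    case False
    then have "R < norm x" "R < norm y"
      using norm_triangle_ineq2[of x y] norm_triangle_ineq2[of y x] xy by (auto simp: norm_minus_commute)
    then show ?thesis using R e by simp
  qed
  then show ?thesis using that[of "min 1 (d / 2)"] d(1) by auto
qed

lemma finite_ball_cover_near_complement:
  fixes K S :: "complex set"
  assumes S: "bounded S" and \<delta>: "\<delta> > 0" and near: "\<And>\<zeta>. \<zeta> \<in> S \<Longrightarrow> \<exists>c. c \<notin> K \<and> norm (c - \<zeta>) \<le> \<delta>"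
  obtains C where "finite C" "C \<inter> K = {}" "S \<subseteq> (\<Union>c\<in>C. ball c (2 * \<delta>))"
proof -
  have "compact (closure S)" using S compact_closure by blast
  moreover have "closure S \<subseteq> (\<Union>c\<in>- K. ball c (2 * \<delta>))"
  proof
    fix x assume "x \<in> closure S"
    then obtain \<zeta> where \<zeta>: "\<zeta> \<in> S" "dist \<zeta> x < \<delta>" using closure_approachable \<delta> by blast
    then obtain c where c: "c \<notin> K" "norm (c - \<zeta>) \<le> \<delta>" using near by blast
    have "dist c x < 2 * \<delta>" using dist_triangle[of c x \<zeta>] \<zeta>(2) c(2) by (simp add: dist_norm)
    then show "x \<in> (\<Union>c\<in>- K. ball c (2 * \<delta>))" using c by auto
  qed
  ultimately obtain C where C: "C \<subseteq> - K" "finite C" "closure S \<subseteq> (\<Union>c\<in>C. ball c (2 * \<delta>))"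
    using compactE_image[of "closure S" "- K" "\<lambda>c. ball c (2 * \<delta>)"] by (metis open_ball)
  show ?thesis by (rule that[of C]) (use C order_trans[OF closure_subset C(3)] in auto)
qed

text \<open>
  The density \<open>\<psi>\<close> lives on discs \<open>ball (c i) r\<close> with \<open>r = 2 * \<delta>\<close> and centres outside \<open>K\<close>. On the disjoint pieces \<open>A i\<close>
  of these discs the Cauchy kernel is replaced by the localized one, which depends on \<open>z\<close> only through
  \<open>G i z\<close> and its square; integration over \<open>\<zeta>\<close> thus leaves a finite linear combination \<open>F\<close> of members
  of the algebra.
\<close>

theorem mergelyan:
  fixes K :: "complex set"
  assumes K: "compact K" and conn: "connected (- K)"
    and cg: "continuous_on K g" and hg: "g holomorphic_on interior K"
  shows "g \<in> poly_approx K"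
proof (rule poly_approx_uniform_closure)
  fix e :: real assume e: "e > 0"
  obtain f R M where f: "continuous_on UNIV f" "\<And>z. z \<in> K \<Longrightarrow> f z = g z" and R: "R > 0"
    "\<And>z. R < norm z \<Longrightarrow> f z = 0" and M: "\<And>z. norm (f z) \<le> M"
    using compactly_supported_extension[OF K cg] by metis
  \<comment> \<open>The total error below is \<open>48000001 * \<omega>\<close>: \<open>\<omega>\<close> from averaging and \<open>2000000 * 24 * \<omega>\<close> from the change of kernel.\<close>
  define \<omega> where "\<omega> = e / 100000000"
  have \<omega>: "\<omega> > 0" using e by (simp add: \<omega>_def)
  obtain \<delta> where \<delta>: "\<delta> > 0" and osc: "\<And>x y. norm (x - y) \<le> \<delta> \<Longrightarrow> norm (f x - f y) \<le> \<omega>"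
    using uniform_oscillation_compact_support[OF f(1) R(2) \<omega>] by metis
  define \<psi> where "\<psi> = cauchy_density f \<delta>"
  have \<psi>_le: "norm (\<psi> \<zeta>) \<le> \<omega> / (pi * \<delta>)" for \<zeta>
    unfolding \<psi>_def by (rule cauchy_density_bound[OF \<delta> f(1)]) (use \<omega> osc in auto)
  have \<psi>_far: "\<psi> \<zeta> = 0" if "R + \<delta> < norm \<zeta>" for \<zeta>
    unfolding \<psi>_def by (rule cauchy_density_far_zero[OF \<delta> R(2) that])
  have [measurable]: "\<psi> \<in> borel_measurable borel"
    unfolding \<psi>_def by (rule cauchy_density_measurable[OF f(1)])
  define S where "S = {\<zeta>. \<psi> \<zeta> \<noteq> 0}"
  have "S \<subseteq> cball 0 (R + \<delta>)" using \<psi>_far by (force simp: S_def not_less)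
  then have bS: "bounded S" using bounded_cball bounded_subset by blast
  have near: "\<exists>c. c \<notin> K \<and> norm (c - \<zeta>) \<le> \<delta>" if "\<zeta> \<in> S" for \<zeta>
  proof (rule ccontr)
    assume "\<not> ?thesis"
    then have sub: "cball \<zeta> \<delta> \<subseteq> K" by (force simp: dist_norm norm_minus_commute)
    then have "ball \<zeta> \<delta> \<subseteq> interior K"
      by (meson ball_subset_cball interior_maximal open_ball order_trans)
    then have "g holomorphic_on ball \<zeta> \<delta>" using hg holomorphic_on_subset by blast
    then have "f holomorphic_on ball \<zeta> \<delta>"
      by (rule holomorphic_transform) (metis f(2) sub ball_subset_cball subsetD)
    then have "\<psi> \<zeta> = 0" unfolding \<psi>_def by (rule cauchy_density_holomorphic_zero[OF \<delta> f(1)])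
    then show False using that by (simp add: S_def)
  qed
  define r where "r = 2 * \<delta>"
  have r: "r > 0" using \<delta> by (simp add: r_def)
  obtain C where C: "finite C" "C \<inter> K = {}" "S \<subseteq> (\<Union>c\<in>C. ball c r)"
    using finite_ball_cover_near_complement[OF bS \<delta> near] unfolding r_def by blast
  obtain c n where c: "C = c ` {i::nat. i < n}"
    using finite_imp_nat_seg_image_inj_on[OF C(1)] by metis
  have "\<forall>i. \<exists>G b. i < n \<longrightarrow> (G \<in> poly_approx K \<and> (\<forall>z\<in>K. \<forall>\<zeta>\<in>ball (c i) r. z \<noteq> \<zeta> \<longrightarrow>
       norm (G z + (\<zeta> - b) * (G z)\<^sup>2 - 1 / (z - \<zeta>)) \<le> 2000000 * kernel_majorant r (z - \<zeta>)))"
  proof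
    fix i
    show "\<exists>G b. i < n \<longrightarrow> (G \<in> poly_approx K \<and> (\<forall>z\<in>K. \<forall>\<zeta>\<in>ball (c i) r. z \<noteq> \<zeta> \<longrightarrow>
       norm (G z + (\<zeta> - b) * (G z)\<^sup>2 - 1 / (z - \<zeta>)) \<le> 2000000 * kernel_majorant r (z - \<zeta>)))"
    proof (cases "i < n")
      case True
      then have "c i \<notin> K" using C(2) c by auto
      from localized_cauchy_kernel[OF K conn this r] show ?thesis unfolding kernel_majorant_def by metis
    qed auto
  qed
  then obtain G b where G: "\<And>i. i < n \<Longrightarrow> G i \<in> poly_approx K"
    and Gb: "\<And>i z \<zeta>. i < n \<Longrightarrow> z \<in> K \<Longrightarrow> \<zeta> \<in> ball (c i) r \<Longrightarrow> z \<noteq> \<zeta> \<Longrightarrow>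
       norm (G i z + (\<zeta> - b i) * (G i z)\<^sup>2 - 1 / (z - \<zeta>)) \<le> 2000000 * kernel_majorant r (z - \<zeta>)"
    by metis
  define A where "A = (\<lambda>i. ball (c i) r - (\<Union>j<i. ball (c j) r))"
  have [measurable, simp]: "A i \<in> sets borel" for i unfolding A_def by auto
  have A_unique: "i = j" if "\<zeta> \<in> A i" "\<zeta> \<in> A j" for i j \<zeta>
    using that by (metis A_def DiffD1 DiffD2 UN_I lessThan_iff linorder_neqE_nat)
  have A_cover: "\<exists>i<n. \<zeta> \<in> A i" if "\<zeta> \<in> S" for \<zeta>
  proof -
    define i where "i = (LEAST i. i < n \<and> \<zeta> \<in> ball (c i) r)"
    have "\<exists>i. i < n \<and> \<zeta> \<in> ball (c i) r" using that C(3) c by blast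
    then have i: "i < n \<and> \<zeta> \<in> ball (c i) r" unfolding i_def by (rule LeastI_ex)
    have "\<zeta> \<notin> ball (c j) r" if "j < i" for j
      using not_less_Least[of j "\<lambda>i. i < n \<and> \<zeta> \<in> ball (c i) r"] that i unfolding i_def[symmetric] by auto
    then show ?thesis using i by (auto simp: A_def)
  qed
  define \<alpha> where "\<alpha> = (\<lambda>i. LINT \<zeta>|lborel. indicator (A i) \<zeta> *\<^sub>R \<psi> \<zeta>)"
  define \<beta> where "\<beta> = (\<lambda>i. LINT \<zeta>|lborel. indicator (A i) \<zeta> *\<^sub>R (\<psi> \<zeta> * (\<zeta> - b i)))"
  define F where "F = (\<lambda>z. \<Sum>i<n. \<alpha> i * G i z + \<beta> i * (G i z)\<^sup>2)"
  have F: "F \<in> poly_approx K" unfolding F_def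
    by (rule poly_approx_sum) (auto intro!: poly_approx_add poly_approx_cmult poly_approx_power K G)
  have fin: "emeasure lborel (cball (0::complex) (R + \<delta>)) < \<infinity>"
    using emeasure_bounded_finite[OF bounded_cball] by simp
  have int\<alpha>: "integrable lborel (\<lambda>\<zeta>. indicator (A i) \<zeta> *\<^sub>R \<psi> \<zeta>)" for i
    by (rule integrableI_bounded_set[where A = "cball 0 (R + \<delta>)" and B = "\<omega> / (pi * \<delta>)"])
       (use fin \<psi>_far \<psi>_le in \<open>auto split: split_indicator intro: order_trans[OF norm_ge_zero]\<close>)
  have int\<beta>: "integrable lborel (\<lambda>\<zeta>. indicator (A i) \<zeta> *\<^sub>R (\<psi> \<zeta> * (\<zeta> - b i)))" for i
  proof (rule integrableI_bounded_set[where A = "cball 0 (R + \<delta>)" and B = "\<omega> / (pi * \<delta>) * (R + \<delta> + norm (b i))"])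
    show "AE \<zeta> in lborel. \<zeta> \<in> cball 0 (R + \<delta>) \<longrightarrow>
       norm (indicator (A i) \<zeta> *\<^sub>R (\<psi> \<zeta> * (\<zeta> - b i))) \<le> \<omega> / (pi * \<delta>) * (R + \<delta> + norm (b i))"
    proof (intro AE_I2 impI)
      fix \<zeta> :: complex assume "\<zeta> \<in> cball 0 (R + \<delta>)"
      then have "norm (\<zeta> - b i) \<le> R + \<delta> + norm (b i)" using norm_triangle_ineq4[of \<zeta> "b i"] by simp
      then have "norm (\<psi> \<zeta> * (\<zeta> - b i)) \<le> \<omega> / (pi * \<delta>) * (R + \<delta> + norm (b i))"
        unfolding norm_mult using \<psi>_le[of \<zeta>] \<omega> \<delta> by (intro mult_mono) auto
      then show "norm (indicator (A i) \<zeta> *\<^sub>R (\<psi> \<zeta> * (\<zeta> - b i))) \<le> \<omega> / (pi * \<delta>) * (R + \<delta> + norm (b i))"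
        by (auto split: split_indicator intro: order_trans[OF norm_ge_zero])
    qed
  qed (use fin \<psi>_far in auto)
  have close: "norm (F z - g z) < e" if z: "z \<in> K" for z
  proof -
    define Q where "Q = (\<lambda>\<zeta>. \<Sum>i<n. G i z * (indicator (A i) \<zeta> *\<^sub>R \<psi> \<zeta>) + (G i z)\<^sup>2 * (indicator (A i) \<zeta> *\<^sub>R (\<psi> \<zeta> * (\<zeta> - b i))))"
    have iQ: "integrable lborel Q" unfolding Q_def
      by (intro Bochner_Integration.integrable_sum Bochner_Integration.integrable_add integrable_mult_right int\<alpha> int\<beta>)
    have FQ: "F z = (LINT \<zeta>|lborel. Q \<zeta>)"
    proof -
      have X: "integrable lborel (\<lambda>\<zeta>. G i z * (indicator (A i) \<zeta> *\<^sub>R \<psi> \<zeta>))"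
        and Y: "integrable lborel (\<lambda>\<zeta>. (G i z)\<^sup>2 * (indicator (A i) \<zeta> *\<^sub>R (\<psi> \<zeta> * (\<zeta> - b i))))" for i
        by (rule integrable_mult_right, rule int\<alpha>) (rule integrable_mult_right, rule int\<beta>)
      have "(LINT \<zeta>|lborel. Q \<zeta>) = (\<Sum>i<n. LINT \<zeta>|lborel. G i z * (indicator (A i) \<zeta> *\<^sub>R \<psi> \<zeta>) + (G i z)\<^sup>2 * (indicator (A i) \<zeta> *\<^sub>R (\<psi> \<zeta> * (\<zeta> - b i))))"
        unfolding Q_def by (rule Bochner_Integration.integral_sum) (rule Bochner_Integration.integrable_add[OF X Y])
      also have "\<dots> = (\<Sum>i<n. G i z * \<alpha> i + (G i z)\<^sup>2 * \<beta> i)"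
        unfolding Bochner_Integration.integral_add[OF X Y] \<alpha>_def \<beta>_def
        by (simp only: integral_mult_right_zero)
      finally show ?thesis by (simp add: F_def mult.commute)
    qed
    have iP: "integrable lborel (\<lambda>\<zeta>. \<psi> \<zeta> / (z - \<zeta>))"
    proof (rule integrableI_bounded)
      have "(\<integral>\<^sup>+\<zeta>. ennreal (norm (\<psi> \<zeta> / (z - \<zeta>))) \<partial>lborel) \<le> ennreal (\<omega> / (pi * \<delta>) * (12 * pi + pi * (R + \<delta>)\<^sup>2))"
        by (rule nn_integral_cauchy_kernel) (use \<psi>_le \<psi>_far \<omega> \<delta> R in auto)
      also have "\<dots> < \<infinity>" by simp
      finally show "(\<integral>\<^sup>+\<zeta>. ennreal (norm (\<psi> \<zeta> / (z - \<zeta>))) \<partial>lborel) < \<infinity>" .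
    qed measurable
    define \<Phi> where "\<Phi> = (LINT \<zeta>|lborel. \<psi> \<zeta> / (z - \<zeta>))"
    have \<Phi>_average: "\<Phi> = (1 / (of_real pi * of_real \<delta> ^ 2)) * (LINT w|lborel. indicator (ball z \<delta>) w *\<^sub>R f w)"
      unfolding \<Phi>_def \<psi>_def by (rule cauchy_transform_density[OF \<delta> f(1) M less_imp_le[OF R(1)] R(2)])
    have "norm (\<Phi> - f z) \<le> \<omega>"
      unfolding \<Phi>_average by (rule ball_average_close[OF \<delta> f(1)]) (use osc \<omega> in auto)
    moreover have "norm (F z - \<Phi>) \<le> 48000000 * \<omega>"
    proof -
      have bd: "norm (Q \<zeta> - \<psi> \<zeta> / (z - \<zeta>)) \<le> \<omega> / (pi * \<delta>) * 2000000 * kernel_majorant r (z - \<zeta>)" if "\<zeta> \<noteq> z" for \<zeta>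
      proof (cases "\<zeta> \<in> S")
        case False
        then have "Q \<zeta> - \<psi> \<zeta> / (z - \<zeta>) = 0" by (simp add: Q_def S_def)
        then show ?thesis using \<omega> \<delta> kernel_majorant_nonneg[of r "z - \<zeta>"] by simp
      next
        case True
        then obtain i where i: "i < n" "\<zeta> \<in> A i" using A_cover by blast
        have ind: "indicator (A j) \<zeta> = (if j = i then 1 else 0 :: real)" for j
          using i(2) A_unique by (auto simp: indicator_def)
        have "Q \<zeta> = (\<Sum>j<n. if j = i then \<psi> \<zeta> * (G i z + (\<zeta> - b i) * (G i z)\<^sup>2) else 0)"
          unfolding Q_def ind by (intro sum.cong) (auto simp: algebra_simps)
        also have "\<dots> = \<psi> \<zeta> * (G i z + (\<zeta> - b i) * (G i z)\<^sup>2)" using i(1) by simp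
        finally have "Q \<zeta> - \<psi> \<zeta> / (z - \<zeta>) = \<psi> \<zeta> * (G i z + (\<zeta> - b i) * (G i z)\<^sup>2 - 1 / (z - \<zeta>))"
          by (simp add: algebra_simps)
        then have "norm (Q \<zeta> - \<psi> \<zeta> / (z - \<zeta>)) = norm (\<psi> \<zeta>) * norm (G i z + (\<zeta> - b i) * (G i z)\<^sup>2 - 1 / (z - \<zeta>))"
          by (simp add: norm_mult)
        also have "\<dots> \<le> \<omega> / (pi * \<delta>) * (2000000 * kernel_majorant r (z - \<zeta>))"
          using \<psi>_le[of \<zeta>] Gb[OF i(1) z, of \<zeta>] i(2) that by (intro mult_mono) (auto simp: A_def intro: order_trans[OF norm_ge_zero])
        finally show ?thesis by simp
      qed
      define c0 where "c0 = \<omega> / (pi * \<delta>) * 2000000"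
      have c0: "c0 \<ge> 0" using \<omega> \<delta> by (simp add: c0_def)
      have "ennreal (norm (F z - \<Phi>)) = ennreal (norm (LINT \<zeta>|lborel. Q \<zeta> - \<psi> \<zeta> / (z - \<zeta>)))"
        unfolding FQ \<Phi>_def by (subst Bochner_Integration.integral_diff[OF iQ iP]) simp
      also have "\<dots> \<le> (\<integral>\<^sup>+\<zeta>. ennreal (norm (Q \<zeta> - \<psi> \<zeta> / (z - \<zeta>))) \<partial>lborel)"
        by (rule integral_norm_bound_ennreal) (intro Bochner_Integration.integrable_diff iQ iP)
      also have "\<dots> \<le> (\<integral>\<^sup>+\<zeta>. ennreal c0 * ennreal (kernel_majorant r (z - \<zeta>)) \<partial>lborel)"
      proof (rule nn_integral_mono_AE)
        show "AE \<zeta> in lborel. ennreal (norm (Q \<zeta> - \<psi> \<zeta> / (z - \<zeta>))) \<le> ennreal c0 * ennreal (kernel_majorant r (z - \<zeta>))"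
          using AE_lborel_singleton[of z]
        proof eventually_elim
          case (elim \<zeta>)
          then have "norm (Q \<zeta> - \<psi> \<zeta> / (z - \<zeta>)) \<le> c0 * kernel_majorant r (z - \<zeta>)"
            using bd unfolding c0_def by blast
          then show ?case using c0 kernel_majorant_nonneg
            by (simp add: ennreal_mult[symmetric] ennreal_leI)
        qed
      qed
      also have "\<dots> = ennreal c0 * (\<integral>\<^sup>+\<zeta>. ennreal (kernel_majorant r (z - \<zeta>)) \<partial>lborel)"
        by (rule nn_integral_cmult) measurable
      also have "\<dots> \<le> ennreal c0 * ennreal (12 * pi * r)"
        by (intro mult_left_mono nn_integral_kernel_majorant r) auto
      also have "\<dots> = ennreal (c0 * (12 * pi * r))" using c0 r by (simp add: ennreal_mult)
      also have "c0 * (12 * pi * r) = 48000000 * \<omega>" using \<delta> by (simp add: c0_def r_def)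
      finally show ?thesis using \<omega> by simp
    qed
    ultimately have "norm (F z - f z) \<le> 48000001 * \<omega>"
      using norm_triangle_ineq[of "F z - \<Phi>" "\<Phi> - f z"] by simp
    also have "\<dots> < e" using e by (simp add: \<omega>_def)
    finally show ?thesis by (simp add: f(2)[OF z])
  qed
  show "\<exists>h\<in>poly_approx K. \<forall>z\<in>K. norm (h z - g z) < e"
    using F close by blast
qed

section \<open>Exponentials as Dirichlet polynomials\<close>

definition lagrange_weight :: "nat \<Rightarrow> nat \<Rightarrow> real \<Rightarrow> real" where
  "lagrange_weight m i x = (\<Prod>j\<in>{..<m} - {i}. (x - real j) / (real i - real j))"

text \<open>
  Both sides are polynomials in \<open>x\<close> of degree less than \<open>m\<close> that agree at the \<open>m\<close> nodes.
\<close>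

lemma lagrange_weight_exact:
  assumes k: "k < m"
  shows "(\<Sum>i<m. lagrange_weight m i x * real i ^ k) = x ^ k"
proof -
  define p where "p = (\<Sum>i<m. smult (real i ^ k) (\<Prod>j\<in>{..<m} - {i}. smult (1 / (real i - real j)) [:- real j, 1:]))"
  have p: "poly p y = (\<Sum>i<m. lagrange_weight m i y * real i ^ k)" for y
    by (simp add: p_def lagrange_weight_def poly_sum poly_prod mult.commute diff_divide_distrib)
  have "degree p \<le> m - 1" unfolding p_def
  proof (rule degree_sum_le)
    fix i assume "i \<in> {..<m}"
    have "degree (\<Prod>j\<in>{..<m} - {i}. smult (1 / (real i - real j)) [:- real j, 1:]) \<le>
        (\<Sum>j\<in>{..<m} - {i}. degree (smult (1 / (real i - real j)) [:- real j, 1:]))"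
      using degree_prod_sum_le[of "{..<m} - {i}" "\<lambda>j. smult (1 / (real i - real j)) [:- real j, 1:]"]
      unfolding o_def by blast
    also have "\<dots> \<le> (\<Sum>j\<in>{..<m} - {i}. 1)" by (intro sum_mono) (auto intro: order_trans[OF degree_smult_le])
    also have "\<dots> = m - 1" using \<open>i \<in> {..<m}\<close> by simp
    finally show "degree (smult (real i ^ k) (\<Prod>j\<in>{..<m} - {i}. smult (1 / (real i - real j)) [:- real j, 1:])) \<le> m - 1"
      using degree_smult_le order_trans by blast
  qed simp
  then have deg: "degree p < m" using k by simp
  have cardinal: "card (real ` {..<m}) = m" by (simp add: card_image)
  have "p = monom 1 k"
  proof (rule poly_eqI_degree[where A = "real ` {..<m}"])
    fix y assume "y \<in> real ` {..<m}"
    then obtain l where l: "l < m" "y = real l" by auto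
    have "lagrange_weight m i y = (if i = l then 1 else 0)" if "i < m" for i
    proof (cases "i = l")
      case True
      then show ?thesis unfolding lagrange_weight_def l(2) by (auto intro!: prod.neutral)
    next
      case False
      then have "\<exists>j\<in>{..<m} - {i}. (y - real j) / (real i - real j) = 0" using l by auto
      then show ?thesis using False unfolding lagrange_weight_def by (auto simp: prod_zero_iff)
    qed
    then have "poly p y = (\<Sum>i<m. if i = l then real l ^ k else 0)" unfolding p by (intro sum.cong) auto
    then show "poly p y = poly (monom 1 k) y" using l by (simp add: poly_monom)
  qed (use deg k cardinal in \<open>auto simp: degree_monom_eq\<close>)
  then have "poly p x = x ^ k" by (simp add: poly_monom)
  then show ?thesis using p by simp
qed

lemma lagrange_weight_bound:
  assumes "i < m" "0 \<le> x" "x \<le> 1"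
  shows "\<bar>lagrange_weight m i x\<bar> \<le> real m ^ m"
proof -
  have "\<bar>lagrange_weight m i x\<bar> = (\<Prod>j\<in>{..<m} - {i}. \<bar>x - real j\<bar> / \<bar>real i - real j\<bar>)"
    by (simp add: lagrange_weight_def abs_prod)
  also have "\<dots> \<le> (\<Prod>j\<in>{..<m} - {i}. real m)"
  proof (intro prod_mono conjI)
    fix j assume j: "j \<in> {..<m} - {i}"
    have "\<bar>x - real j\<bar> \<le> real m" using assms j by auto
    moreover have "1 \<le> \<bar>real i - real j\<bar>" using j by auto
    ultimately show "\<bar>x - real j\<bar> / \<bar>real i - real j\<bar> \<le> real m"
      by (metis abs_ge_zero div_by_1 frac_le less_numeral_extra(1) order_trans)
  qed simp
  also have "\<dots> = real m ^ (m - 1)" using assms by simp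
  also have "\<dots> \<le> real m ^ m" using assms by (intro power_increasing) auto
  finally show ?thesis .
qed

text \<open>
  The derivative of order \<open>m\<close> of \<open>u powr (-s)\<close> has modulus at most
  \<open>(R + m) ^ m * u powr (R - m)\<close>; the condition \<open>R + \<sigma> \<le> m\<close> turns the power into decay of order \<open>\<sigma>\<close>.
\<close>

lemma powr_taylor_bound:
  fixes s :: complex
  assumes n: "n \<ge> 1" and s: "norm s \<le> R" and m: "R + \<sigma> \<le> real m" "m \<ge> 1" and \<sigma>: "\<sigma> > 0"
  obtains c :: "nat \<Rightarrow> complex" where
    "\<And>u. real n \<le> u \<Longrightarrow> u \<le> real n + real m \<Longrightarrow>
      norm (of_real u powr (- s) - (\<Sum>j<m. c j * of_real (u - real n) ^ j)) \<le>
      (R + real m) ^ m * real m ^ m * real n powr (- \<sigma>)"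
proof -
  define S where "S = (of_real :: real \<Rightarrow> complex) ` {real n..real n + real m}"
  define f where "f = (\<lambda>i u. (\<Prod>j<i. - s - of_nat j) * u powr (- s - of_nat i))"
  define c where "c = (\<lambda>j. f j (of_real (real n)) / fact j)"
  have R0: "R \<ge> 0" using s norm_ge_zero order_trans by blast
  have "linear (of_real :: real \<Rightarrow> complex)" by (rule bounded_linear.linear) (rule bounded_linear_of_real)
  then have conv: "convex S" unfolding S_def by (intro convex_linear_image) auto
  obtain m' where m': "m = Suc m'" using m(2) by (cases m) auto
  have Sb: "norm (f m x) \<le> (R + real m) ^ m * real n powr (- \<sigma>)" if "x \<in> S" for x
  proof -
    obtain u where u: "x = of_real u" "real n \<le> u" using \<open>x \<in> S\<close> by (auto simp: S_def)
    have u1: "u \<ge> 1" using u n by simp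
    have "norm (\<Prod>j<m. - s - of_nat j) \<le> (\<Prod>j<m. R + real m)"
      unfolding prod_norm[symmetric]
    proof (intro prod_mono conjI)
      fix j assume "j \<in> {..<m}"
      then show "norm (- s - of_nat j) \<le> R + real m" using norm_triangle_ineq4[of "- s" "of_nat j"] s by simp
    qed simp
    moreover have "norm (x powr (- s - of_nat m)) \<le> real n powr (- \<sigma>)"
    proof -
      have "norm (x powr (- s - of_nat m)) = u powr (- Re s - real m)"
        using u u1 by (subst norm_powr_real_powr) auto
      also have "\<dots> \<le> u powr (- \<sigma>)"
        using u1 abs_Re_le_cmod[of s] s m by (intro powr_mono) auto
      also have "\<dots> \<le> real n powr (- \<sigma>)" using u n \<sigma> by (intro powr_mono2') auto
      finally show ?thesis .
    qed
    ultimately show ?thesis unfolding f_def norm_mult using R0 by (intro mult_mono) auto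
  qed
  have est: "norm (f 0 (of_real u) - (\<Sum>i\<le>m'. f i (of_real (real n)) * (of_real u - of_real (real n)) ^ i / fact i))
      \<le> ((R + real m) ^ m * real n powr (- \<sigma>)) * norm (of_real u - of_real (real n) :: complex) ^ Suc m' / fact m'"
    if u: "real n \<le> u" "u \<le> real n + real m" for u
  proof (rule complex_Taylor[OF conv])
    show "(f i has_field_derivative f (Suc i) x) (at x within S)" if "x \<in> S" "i \<le> m'" for i x
    proof -
      obtain t where t: "x = of_real t" "real n \<le> t" using \<open>x \<in> S\<close> by (auto simp: S_def)
      then have "x \<notin> \<real>\<^sub>\<le>\<^sub>0" using n by (auto simp: complex_nonpos_Reals_iff)
      then have "((\<lambda>u. u powr (- s - of_nat i)) has_field_derivative (- s - of_nat i) * x powr (- s - of_nat i - 1)) (at x)"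
        by (rule has_field_derivative_powr)
      then have "(f i has_field_derivative (\<Prod>j<i. - s - of_nat j) * ((- s - of_nat i) * x powr (- s - of_nat i - 1))) (at x)"
        unfolding f_def by (rule DERIV_cmult)
      moreover have "(\<Prod>j<i. - s - of_nat j) * ((- s - of_nat i) * x powr (- s - of_nat i - 1)) = f (Suc i) x"
        by (simp add: f_def algebra_simps)
      ultimately show ?thesis using has_field_derivative_at_within by metis
    qed
    show "norm (f (Suc m') x) \<le> (R + real m) ^ m * real n powr (- \<sigma>)" if "x \<in> S" for x
      using Sb[OF that] m' by simp
    show "of_real (real n) \<in> S" "of_real u \<in> S"
      unfolding S_def by (rule imageI, use u in simp)+
  qed
  show ?thesis
  proof (rule that[of c])
    fix u assume u: "real n \<le> u" "u \<le> real n + real m"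
    have "(\<Sum>i\<le>m'. f i (of_real (real n)) * (of_real u - of_real (real n)) ^ i / fact i) = (\<Sum>j<m. c j * of_real (u - real n) ^ j)"
      unfolding m' lessThan_Suc_atMost c_def by (intro sum.cong) auto
    moreover have "f 0 (of_real u) = of_real u powr (- s)" by (simp add: f_def)
    moreover have "((R + real m) ^ m * real n powr (- \<sigma>)) * norm (of_real u - of_real (real n) :: complex) ^ Suc m' / fact m'
       \<le> ((R + real m) ^ m * real n powr (- \<sigma>)) * real m ^ m / 1"
    proof (intro frac_le mult_left_mono)
      have "norm (of_real u - of_real (real n) :: complex) = u - real n"
        using u by (metis abs_of_nonneg diff_ge_0_iff_ge norm_of_real of_real_diff)
      then show "norm (of_real u - of_real (real n) :: complex) ^ Suc m' \<le> real m ^ m"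
        unfolding m'[symmetric] using u by (intro power_mono) auto
    qed (use R0 in \<open>auto simp: fact_ge_1\<close>)
    ultimately show "norm (of_real u powr (- s) - (\<Sum>j<m. c j * of_real (u - real n) ^ j)) \<le>
      (R + real m) ^ m * real m ^ m * real n powr (- \<sigma>)"
      using est[OF u] by (simp add: mult_ac)
  qed
qed

text \<open>
  With \<open>y = exp x\<close> and \<open>n = \<lfloor>y\<rfloor>\<close>, interpolate \<open>u \<mapsto> u powr (-s)\<close> at \<open>n, ..., n + m - 1\<close> and evaluate at
  \<open>y\<close>. Interpolation reproduces the Taylor polynomial at \<open>n\<close>, so only Taylor remainders contribute,
  and these decay like \<open>n powr -\<sigma>\<close>. The weights are bounded independently of \<open>n\<close>, which gives the
  same order for the norm.
\<close>

lemma exponential_dirichlet_approximation: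
  fixes K :: "complex set"
  assumes K: "bounded K" and \<sigma>: "\<sigma> > 0"
  shows "\<exists>C\<ge>0. \<forall>x\<ge>0. \<exists>N a. (\<forall>n>N. a n = 0) \<and>
       (\<forall>s\<in>K. norm ((\<Sum>n=1..N. a n * of_nat n powr (- s)) - exp (- of_real x * s)) \<le> C * exp (- x * \<sigma>)) \<and>
       (\<Sum>n=1..N. norm (a n) * real n powr (- \<sigma>)) \<le> C * exp (- x * \<sigma>)"
proof -
  obtain R where R: "R > 0" "\<And>s. s \<in> K \<Longrightarrow> norm s \<le> R" using K bounded_pos by blast
  obtain m :: nat where "R + \<sigma> \<le> real m" using real_arch_simple by blast
  then have m: "R + \<sigma> \<le> real m" "m \<ge> 1" using R \<sigma> by (auto simp: Suc_le_eq intro!: Nat.gr0I)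
  define L where "L = real m ^ m"
  define B where "B = (R + real m) ^ m * real m ^ m"
  have L: "L \<ge> 1" using m by (simp add: L_def)
  have B: "B \<ge> 0" using R by (simp add: B_def)
  define C where "C = (real m * L * B + B + real m * L) * 2 powr \<sigma>"
  have C: "C \<ge> 0" unfolding C_def using L B by simp
  have "\<exists>N a. (\<forall>n>N. a n = 0) \<and>
       (\<forall>s\<in>K. norm ((\<Sum>n=1..N. a n * of_nat n powr (- s)) - exp (- of_real x * s)) \<le> C * exp (- x * \<sigma>)) \<and>
       (\<Sum>n=1..N. norm (a n) * real n powr (- \<sigma>)) \<le> C * exp (- x * \<sigma>)" if x: "x \<ge> 0" for x
  proof -
    define y where "y = exp x"
    have y: "y \<ge> 1" using x by (simp add: y_def)
    define n where "n = nat \<lfloor>y\<rfloor>"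
    define \<theta> where "\<theta> = y - real n"
    have n: "n \<ge> 1" using y by (simp add: n_def le_nat_floor)
    have \<theta>: "0 \<le> \<theta>" "\<theta> \<le> 1" using y by (auto simp: \<theta>_def n_def) linarith
    define q where "q = real n powr (- \<sigma>)"
    have q0: "q \<ge> 0" by (simp add: q_def)
    have q: "q \<le> 2 powr \<sigma> * exp (- x * \<sigma>)"
    proof -
      have "y / 2 \<le> real n" using \<theta> n by (simp add: \<theta>_def)
      then have "q \<le> (y / 2) powr (- \<sigma>)" unfolding q_def using y \<sigma> by (intro powr_mono2') auto
      also have "\<dots> = y powr (- \<sigma>) * 2 powr \<sigma>" using y by (simp add: powr_divide powr_minus divide_simps)
      also have "y powr (- \<sigma>) = exp (- x * \<sigma>)" by (simp add: y_def powr_def mult.commute)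
      finally show ?thesis by (simp add: mult.commute)
    qed
    define a where "a = (\<lambda>k. if n \<le> k \<and> k < n + m then of_real (lagrange_weight m (k - n) \<theta>) else 0 :: complex)"
    \<comment> \<open>Stated for an arbitrary summand \<open>h\<close>, as it serves both the values on \<open>K\<close> and the norm.\<close>
    have reindex: "(\<Sum>k=1..n + m. h k (a k)) = (\<Sum>i<m. h (n + i) (of_real (lagrange_weight m i \<theta>)))"
      if "\<And>k. h k 0 = 0" for h :: "nat \<Rightarrow> complex \<Rightarrow> 'z::comm_monoid_add"
    proof -
      have "(\<Sum>k=1..n + m. h k (a k)) = (\<Sum>k\<in>{n..<n + m}. h k (a k))"
        by (rule sum.mono_neutral_right) (use n that in \<open>auto simp: a_def\<close>)
      also have "\<dots> = (\<Sum>i<m. h (n + i) (a (n + i)))"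
        by (rule sum.reindex_bij_witness[of _ "\<lambda>i. n + i" "\<lambda>k. k - n"]) auto
      finally show ?thesis by (simp add: a_def)
    qed
    have wt: "\<bar>lagrange_weight m i \<theta>\<bar> \<le> L" if "i < m" for i
      unfolding L_def using lagrange_weight_bound[OF that \<theta>] .
    have err: "norm ((\<Sum>k=1..n + m. a k * of_nat k powr (- s)) - exp (- of_real x * s)) \<le> (real m * L * B + B) * q" if s: "s \<in> K" for s
    proof -
      obtain c :: "nat \<Rightarrow> complex" where c: "\<And>u. real n \<le> u \<Longrightarrow> u \<le> real n + real m \<Longrightarrow>
          norm (of_real u powr (- s) - (\<Sum>j<m. c j * of_real (u - real n) ^ j)) \<le> B * q"
        using powr_taylor_bound[OF n R(2)[OF s] m \<sigma>] unfolding B_def q_def by blast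
      define T where "T = (\<lambda>v. \<Sum>j<m. c j * of_real v ^ j)"
      define w where "w = (\<lambda>i. of_real (lagrange_weight m i \<theta>) :: complex)"
      have cT: "norm (of_real (real n + v) powr (- s) - T v) \<le> B * q" if "0 \<le> v" "v \<le> real m" for v
        using c[of "real n + v"] that by (simp add: T_def)
      have "(\<Sum>i<m. w i * T (real i)) = (\<Sum>i<m. \<Sum>j<m. w i * (c j * of_real (real i) ^ j))"
        by (simp add: T_def sum_distrib_left)
      also have "\<dots> = (\<Sum>j<m. \<Sum>i<m. w i * (c j * of_real (real i) ^ j))" by (rule sum.swap)
      also have "\<dots> = (\<Sum>j<m. c j * of_real (\<Sum>i<m. lagrange_weight m i \<theta> * real i ^ j))"
        by (simp add: w_def sum_distrib_left mult_ac)
      also have "\<dots> = T \<theta>" unfolding T_def by (intro sum.cong) (auto simp: lagrange_weight_exact)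
      finally have exact: "(\<Sum>i<m. w i * T (real i)) = T \<theta>" .
      have "exp (- of_real x * s) = of_real (real n + \<theta>) powr (- s)"
      proof -
        have "real n + \<theta> = exp x" by (simp add: \<theta>_def y_def)
        then show ?thesis by (simp add: powr_def Ln_of_real exp_of_real[symmetric] mult.commute)
      qed
      then have "(\<Sum>k=1..n + m. a k * of_nat k powr (- s)) - exp (- of_real x * s) =
        (\<Sum>i<m. w i * of_nat (n + i) powr (- s)) - of_real (real n + \<theta>) powr (- s)"
        using reindex[of "\<lambda>k z. z * of_nat k powr (- s)"] by (simp add: w_def)
      also have "\<dots> = (\<Sum>i<m. w i * (of_real (real n + real i) powr (- s) - T (real i))) - (of_real (real n + \<theta>) powr (- s) - T \<theta>)"
        unfolding right_diff_distrib sum_subtractf exact by simp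
      also have "norm \<dots> \<le> norm (\<Sum>i<m. w i * (of_real (real n + real i) powr (- s) - T (real i))) + norm (of_real (real n + \<theta>) powr (- s) - T \<theta>)"
        by (rule norm_triangle_ineq4)
      also have "\<dots> \<le> (\<Sum>i<m. L * (B * q)) + B * q"
      proof (rule add_mono[OF sum_norm_le cT])
        show "norm (w i * (of_real (real n + real i) powr (- s) - T (real i))) \<le> L * (B * q)" if "i \<in> {..<m}" for i
          unfolding norm_mult using wt[of i] cT[of "real i"] that L by (intro mult_mono) (auto simp: w_def)
      qed (use \<theta> m in auto)
      also have "\<dots> = (real m * L * B + B) * q" by (simp add: algebra_simps)
      finally show ?thesis .
    qed
    have nrm: "(\<Sum>k=1..n + m. norm (a k) * real k powr (- \<sigma>)) \<le> (real m * L) * q"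
    proof -
      have "(\<Sum>k=1..n + m. norm (a k) * real k powr (- \<sigma>)) = (\<Sum>i<m. \<bar>lagrange_weight m i \<theta>\<bar> * real (n + i) powr (- \<sigma>))"
        using reindex[of "\<lambda>k z. norm z * real k powr (- \<sigma>)"] by simp
      also have "\<dots> \<le> (\<Sum>i<m. L * q)"
        unfolding q_def using wt L n \<sigma> by (intro sum_mono mult_mono powr_mono2') auto
      finally show ?thesis by simp
    qed
    have le: "X * q \<le> C * exp (- x * \<sigma>)" if "0 \<le> X" "X \<le> real m * L * B + B + real m * L" for X
    proof -
      have "X * q \<le> (real m * L * B + B + real m * L) * (2 powr \<sigma> * exp (- x * \<sigma>))"
        using that q q0 by (intro mult_mono) auto
      then show ?thesis by (simp add: C_def mult.assoc)
    qed
    show ?thesis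
    proof (intro exI[of _ "n + m"] exI[of _ a] conjI ballI)
      show "\<forall>k>n + m. a k = 0" by (simp add: a_def)
      show "norm ((\<Sum>n=1..n + m. a n * of_nat n powr (- s)) - exp (- of_real x * s)) \<le> C * exp (- x * \<sigma>)" if "s \<in> K" for s
        using err[OF that] by (rule order_trans) (intro le, use L B in auto)
      show "(\<Sum>n=1..n + m. norm (a n) * real n powr (- \<sigma>)) \<le> C * exp (- x * \<sigma>)"
        using nrm by (rule order_trans) (intro le, use L B in auto)
    qed
  qed
  then show ?thesis using C by blast
qed

section \<open>Approximation by exponential sums and by Dirichlet polynomials\<close>

text \<open>
  An instance of Janiszewski's theorem, the empty set being connected.
\<close>

lemma connected_complement_disjoint_Un:
  fixes S T :: "complex set"
  assumes "compact S" "closed T" "S \<inter> T = {}" "connected (- S)" "connected (- T)"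
  shows "connected (- (S \<union> T))"
  unfolding connected_iff_connected_component
proof (intro ballI)
  fix x y assume "x \<in> - (S \<union> T)" "y \<in> - (S \<union> T)"
  then have "connected_component (- S) x y" "connected_component (- T) x y"
    using assms(4,5) by (auto simp: connected_iff_connected_component)
  then show "connected_component (- (S \<union> T)) x y"
    using assms by (intro Janiszewski) auto
qed

lemma poly_coeff_bound:
  fixes P :: "complex poly"
  assumes r: "r > 0" and P: "\<And>w. norm w = r \<Longrightarrow> norm (poly P w) \<le> \<eta>"
  shows "norm (coeff P k) \<le> \<eta> / r ^ k"
proof -
  have "(deriv ^^ k) (poly P) = poly ((pderiv ^^ k) P)"
  proof (induction k)
    case (Suc k)
    have "deriv (poly Q) = poly (pderiv Q)" for Q :: "complex poly"
      by (rule ext) (rule DERIV_imp_deriv, rule poly_DERIV)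
    then show ?case using Suc by simp
  qed simp
  then have "(deriv ^^ k) (poly P) 0 = fact k * coeff P k"
    by (simp add: poly_0_coeff_0 coeff_higher_pderiv pochhammer_fact)
  moreover have "norm ((deriv ^^ k) (poly P) 0) \<le> fact k * \<eta> / r ^ k"
    by (rule Cauchy_inequality) (use r P in \<open>auto intro!: holomorphic_intros continuous_intros\<close>)
  ultimately have "fact k * norm (coeff P k) \<le> fact k * (\<eta> / r ^ k)" by (simp add: norm_mult)
  then show ?thesis by (rule mult_left_le_imp_le) simp
qed

text \<open>
  Mergelyan's theorem for the disjoint union of a disc about \<open>0\<close> and the image of \<open>K\<close> under
  \<open>s \<mapsto> exp (-a * s)\<close>. The target function is \<open>0\<close> near the disc and \<open>p (- Ln w / a)\<close> near the image, and
  both are holomorphic on open neighbourhoods; having a polynomial \<open>p\<close> here instead of a function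
  that is holomorphic only on the interior of \<open>K\<close> avoids comparing the interiors of \<open>K\<close> and of its image.
\<close>

lemma exponential_sum_approximation:
  fixes K :: "complex set"
  assumes K: "compact K" and left: "K \<subseteq> {s. Re s \<le> 0}" and conn: "connected (- K)" and \<sigma>: "\<sigma> > 0"
  shows "\<exists>a>0. \<exists>\<rho>. 0 < \<rho> \<and> \<rho> < 1 \<and> (\<forall>p \<eta>. \<eta> > 0 \<longrightarrow> (\<exists>P. (\<forall>s\<in>K. norm (poly P (exp (- of_real a * s)) - poly p s) < \<eta>) \<and>
       (\<forall>k. norm (coeff P k) * exp (- (a * real k) * \<sigma>) \<le> \<eta> * \<rho> ^ k)))"
proof -
  obtain R where R: "R > 0" "\<And>s. s \<in> K \<Longrightarrow> norm s \<le> R"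
    using compact_imp_bounded[OF K] bounded_pos by blast
  \<comment> \<open>Then \<open>\<bar>Im (a * s)\<bar> \<le> 1 < pi / 2\<close> on \<open>K\<close>, so \<open>Ln\<close> inverts \<open>E\<close> and the image stays in the right half-plane.\<close>
  define a where "a = 1 / R"
  have a: "a > 0" using R by (simp add: a_def)
  define E where "E = (\<lambda>s. exp (- of_real a * s) :: complex)"
  have Im: "\<bar>a * Im s\<bar> \<le> 1" if "s \<in> K" for s
    using abs_Im_le_cmod[of s] R(2)[OF that] R(1) by (simp add: a_def)
  have LnE: "Ln (E s) = - of_real a * s" if "s \<in> K" for s
    unfolding E_def using Im[OF that] pi_gt3 by (intro Ln_exp) auto
  have ReE: "Re (E s) > 0" if "s \<in> K" for s
  proof -
    have "cos (- (a * Im s)) > 0" using Im[OF that] pi_gt3 by (intro cos_gt_zero_pi) auto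
    then show ?thesis by (simp add: E_def Re_exp)
  qed
  have normE: "norm (E s) \<ge> 1" if "s \<in> K" for s
    using left that a by (auto simp: E_def mult_nonneg_nonpos)
  define L where "L = E ` K"
  have cE: "continuous_on K E" unfolding E_def by (intro continuous_intros)
  have injE: "inj_on E K"
  proof (rule inj_onI)
    fix s t assume "s \<in> K" "t \<in> K" "E s = E t"
    then have "of_real a * s = of_real a * t" using LnE by (metis minus_mult_left neg_equal_iff_equal)
    then show "s = t" using a by simp
  qed
  have L: "compact L" unfolding L_def by (rule compact_continuous_image[OF cE K])
  have "K homeomorphic L" unfolding L_def by (rule homeomorphic_compact[OF K cE refl injE])
  then have connL: "connected (- L)"
    using homotopy_eqv_separation[OF homeomorphic_imp_homotopy_eqv K L] conn by blast
  \<comment> \<open>The square of \<open>\<rho>\<close> is \<open>exp (- a * \<sigma>)\<close>; Cauchy's estimates cost one factor \<open>\<rho> ^ k\<close> and leave the other.\<close>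
  define \<rho> where "\<rho> = exp (- a * \<sigma> / 2)"
  have \<rho>: "0 < \<rho>" "\<rho> < 1" using a \<sigma> by (auto simp: \<rho>_def)
  define \<rho>' where "\<rho>' = (\<rho> + 1) / 2"
  have \<rho>': "\<rho> < \<rho>'" "\<rho>' < 1" using \<rho> by (auto simp: \<rho>'_def)
  define K' where "K' = cball 0 \<rho> \<union> L"
  have K': "compact K'" unfolding K'_def using L by (intro compact_Un) auto
  have disj: "cball 0 \<rho> \<inter> L = {}" using normE \<rho> by (force simp: L_def)
  have conn': "connected (- K')" unfolding K'_def
    by (rule connected_complement_disjoint_Un[OF compact_cball compact_imp_closed[OF L] disj _ connL])
       (rule connected_complement_bounded_convex, auto)
  have main: "\<exists>P. (\<forall>s\<in>K. norm (poly P (exp (- of_real a * s)) - poly p s) < \<eta>) \<and>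
       (\<forall>k. norm (coeff P k) * exp (- (a * real k) * \<sigma>) \<le> \<eta> * \<rho> ^ k)" if \<eta>: "\<eta> > 0" for p \<eta>
  proof -
    \<comment> \<open>The circle of radius \<open>\<rho>'\<close> separates the disc from \<open>L\<close>.\<close>
    define G where "G = (\<lambda>w. if norm w < \<rho>' then 0 else poly p (- Ln w / of_real a))"
    define A where "A = ball (0::complex) \<rho>'"
    define B where "B = {w::complex. \<rho>' < norm w} \<inter> {w. 0 < Re w}"
    have oB: "open B" unfolding B_def by (intro open_Int open_Collect_less continuous_intros)
    have "(\<lambda>w. 0) holomorphic_on A" by simp
    then have "G holomorphic_on A" by (rule holomorphic_transform) (auto simp: A_def G_def)
    moreover have "(\<lambda>w. poly p (- Ln w / of_real a)) holomorphic_on B"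
    proof -
      have "Ln holomorphic_on B"
        by (rule holomorphic_on_Ln) (auto simp: B_def complex_nonpos_Reals_iff)
      then have "(\<lambda>w. - Ln w / of_real a) holomorphic_on B"
        by (intro holomorphic_on_divide holomorphic_on_minus holomorphic_on_const) (use a in auto)
      moreover have "poly p holomorphic_on UNIV"
        by (rule holomorphic_onI) (auto simp: field_differentiable_def intro: poly_DERIV)
      ultimately show ?thesis
        using holomorphic_on_compose_gen[of "\<lambda>w. - Ln w / of_real a" B "poly p" UNIV] by (simp add: o_def)
    qed
    then have "G holomorphic_on B" by (rule holomorphic_transform) (auto simp: B_def G_def)
    ultimately have hol: "G holomorphic_on A \<union> B" by (intro holomorphic_on_Un oB) (auto simp: A_def)
    have "L \<subseteq> B" using normE ReE \<rho>' by (force simp: L_def B_def)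
    then have sub: "K' \<subseteq> A \<union> B" using \<rho>' by (auto simp: K'_def A_def)
    have "G \<in> poly_approx K'"
    proof (rule mergelyan[OF K' conn'])
      show "continuous_on K' G" using holomorphic_on_imp_continuous_on[OF hol] sub continuous_on_subset by blast
      show "G holomorphic_on interior K'" using hol sub interior_subset holomorphic_on_subset by (metis order_trans)
    qed
    then obtain P where P: "\<And>w. w \<in> K' \<Longrightarrow> norm (poly P w - G w) < \<eta>" using poly_approxE \<eta> by blast
    have 1: "norm (poly P (E s) - poly p s) < \<eta>" if s: "s \<in> K" for s
    proof -
      have "G (E s) = poly p s" using normE[OF s] \<rho>' a by (simp add: G_def LnE[OF s])
      then show ?thesis using P[of "E s"] s by (simp add: K'_def L_def)
    qed
    have 2: "norm (coeff P k) * exp (- (a * real k) * \<sigma>) \<le> \<eta> * \<rho> ^ k" for k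
    proof -
      have coeff_le: "norm (coeff P k) \<le> \<eta> / \<rho> ^ k"
      proof (rule poly_coeff_bound[OF \<rho>(1)])
        show "norm (poly P w) \<le> \<eta>" if "norm w = \<rho>" for w
          using P[of w] that \<rho>' by (simp add: K'_def G_def)
      qed
      have square: "exp (- (a * real k) * \<sigma>) = \<rho> ^ k * \<rho> ^ k"
        by (simp add: \<rho>_def exp_of_nat_mult[symmetric] exp_add[symmetric] algebra_simps)
      have "norm (coeff P k) * exp (- (a * real k) * \<sigma>) \<le> (\<eta> / \<rho> ^ k) * (\<rho> ^ k * \<rho> ^ k)"
        unfolding square by (rule mult_right_mono[OF coeff_le]) (use \<rho> in simp)
      also have "\<dots> = \<eta> * \<rho> ^ k" using \<rho> by simp
      finally show ?thesis .
    qed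
    show ?thesis using 1 2 unfolding E_def by blast
  qed
  show ?thesis
    by (rule exI[of _ a], rule conjI[OF a], rule exI[of _ \<rho>]) (use \<rho> main in blast)
qed

text \<open>
  Every exponential \<open>exp (-b * k * s)\<close> of the approximating sum is replaced by a Dirichlet polynomial.
  The errors and the norms, weighted by the coefficients of \<open>P\<close>, add up to at most
  \<open>\<Sum>k. C * \<eta> * \<rho> ^ k = C * \<eta> / (1 - \<rho>)\<close>.
\<close>

lemma small_dirichlet_polynomial_approximation:
  fixes K :: "complex set"
  assumes K: "compact K" and left: "K \<subseteq> {s. Re s \<le> 0}" and conn: "connected (- K)"
    and g: "continuous_on K g" "g holomorphic_on interior K" and \<sigma>: "\<sigma> > 0" and e: "e > 0"
  shows "\<exists>N a. (\<forall>n>N. a n = 0) \<and>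
    (\<forall>s\<in>K. norm ((\<Sum>n=1..N. a n * of_nat n powr (- s)) - g s) < e) \<and>
    (\<Sum>n=1..N. norm (a n) * real n powr (- \<sigma>)) < e"
proof -
  obtain C where C: "C \<ge> 0" and ex: "\<And>x. x \<ge> 0 \<Longrightarrow> \<exists>N a. (\<forall>n>N. a n = 0) \<and>
       (\<forall>s\<in>K. norm ((\<Sum>n=1..N. a n * of_nat n powr (- s)) - exp (- of_real x * s)) \<le> C * exp (- x * \<sigma>)) \<and>
       (\<Sum>n=1..N. norm (a n) * real n powr (- \<sigma>)) \<le> C * exp (- x * \<sigma>)"
    using exponential_dirichlet_approximation[OF compact_imp_bounded[OF K] \<sigma>] by (elim exE conjE) simp
  obtain b \<rho> where b: "b > 0" and \<rho>: "0 < \<rho>" "\<rho> < 1"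
    and sum: "\<And>p \<eta>. \<eta> > 0 \<Longrightarrow> \<exists>P. (\<forall>s\<in>K. norm (poly P (exp (- of_real b * s)) - poly p s) < \<eta>) \<and>
       (\<forall>k. norm (coeff P k) * exp (- (b * real k) * \<sigma>) \<le> \<eta> * \<rho> ^ k)"
    using exponential_sum_approximation[OF K left conn \<sigma>] by (elim exE conjE) simp
  define D where "D = 1 + C / (1 - \<rho>)"
  have D: "D \<ge> 1" unfolding D_def using C \<rho> by simp
  define \<eta> where "\<eta> = e / (3 * D)"
  have \<eta>: "\<eta> > 0" unfolding \<eta>_def using D e by (intro divide_pos_pos mult_pos_pos) auto
  have \<eta>e: "\<eta> + C * \<eta> / (1 - \<rho>) = e / 3"
  proof -
    have "\<eta> + C * \<eta> / (1 - \<rho>) = \<eta> * D" unfolding D_def by (simp add: algebra_simps)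
    also have "\<dots> = e / 3" unfolding \<eta>_def using D by simp
    finally show ?thesis .
  qed
  obtain p where p: "\<And>z. z \<in> K \<Longrightarrow> norm (poly p z - g z) < e / 3"
    using poly_approxE[OF mergelyan[OF K conn g], of "e / 3"] e by auto
  obtain P where P: "\<And>s. s \<in> K \<Longrightarrow> norm (poly P (exp (- of_real b * s)) - poly p s) < \<eta>"
    and Pc: "\<And>k. norm (coeff P k) * exp (- (b * real k) * \<sigma>) \<le> \<eta> * \<rho> ^ k"
    using sum[OF \<eta>, of p] by blast
  define Q where "Q = (\<lambda>k N a. (\<forall>n>N. a n = 0) \<and>
       (\<forall>s\<in>K. norm ((\<Sum>n=1..N. a n * of_nat n powr (- s)) - exp (- of_real (b * real k) * s)) \<le> C * exp (- (b * real k) * \<sigma>)) \<and>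
       (\<Sum>n=1..N. norm (a n) * real n powr (- \<sigma>)) \<le> C * exp (- (b * real k) * \<sigma>))"
  have "\<forall>k. \<exists>N a. Q k N a" unfolding Q_def using b by (intro allI ex) simp
  then obtain N where "\<forall>k. \<exists>a. Q k (N k) a" by (rule choice[THEN exE])
  then obtain a where a: "\<forall>k. Q k (N k) (a k)" by (rule choice[THEN exE])
  have a0: "a k n = 0" if "N k < n" for k n
    using a that by (simp add: Q_def)
  have a1: "norm ((\<Sum>n=1..N k. a k n * of_nat n powr (- s)) - exp (- of_real (b * real k) * s)) \<le> C * exp (- (b * real k) * \<sigma>)"
    if "s \<in> K" for k s using a that unfolding Q_def by blast
  have a2: "(\<Sum>n=1..N k. norm (a k n) * real n powr (- \<sigma>)) \<le> C * exp (- (b * real k) * \<sigma>)" for k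
    using a unfolding Q_def by blast
  define d where "d = degree P"
  define M where "M = (\<Sum>k\<le>d. N k)"
  have NM: "N k \<le> M" if "k \<le> d" for k unfolding M_def using that by (intro member_le_sum) auto
  have ext: "(\<Sum>n=1..M. h n (a k n)) = (\<Sum>n=1..N k. h n (a k n))" if "k \<le> d" "\<And>n. h n 0 = 0" for k and h :: "nat \<Rightarrow> complex \<Rightarrow> 'z::comm_monoid_add"
    by (rule sum.mono_neutral_right) (use NM[OF that(1)] a0 that(2) in auto)
  define A where "A = (\<lambda>n. \<Sum>k\<le>d. coeff P k * a k n)"
  have geom: "(\<Sum>k\<le>d. norm (coeff P k) * (C * exp (- (b * real k) * \<sigma>))) \<le> C * \<eta> / (1 - \<rho>)"
  proof -
    have "(\<Sum>k\<le>d. norm (coeff P k) * (C * exp (- (b * real k) * \<sigma>))) \<le> (\<Sum>k\<le>d. C * \<eta> * \<rho> ^ k)"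
      using mult_left_mono[OF Pc C] by (intro sum_mono) (simp add: mult_ac)
    also have "\<dots> = C * \<eta> * (\<Sum>k\<le>d. \<rho> ^ k)" by (simp add: sum_distrib_left)
    also have "\<dots> \<le> C * \<eta> * (\<Sum>k. \<rho> ^ k)"
      using \<rho> C \<eta> by (intro mult_left_mono sum_le_suminf summable_geometric) auto
    also have "\<dots> = C * \<eta> / (1 - \<rho>)" using suminf_geometric[of \<rho>] \<rho> by simp
    finally show ?thesis .
  qed
  show ?thesis
  proof (intro exI[of _ M] exI[of _ A] conjI ballI allI impI)
    show "A n = 0" if "n > M" for n
      unfolding A_def by (rule sum.neutral) (use a0 NM that in \<open>auto intro: le_less_trans\<close>)
    have "(\<Sum>n=1..M. norm (A n) * real n powr (- \<sigma>)) \<le> (\<Sum>n=1..M. \<Sum>k\<le>d. norm (coeff P k) * (norm (a k n) * real n powr (- \<sigma>)))"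
    proof (intro sum_mono)
      fix n
      have "norm (A n) * real n powr (- \<sigma>) \<le> (\<Sum>k\<le>d. norm (coeff P k * a k n)) * real n powr (- \<sigma>)"
        unfolding A_def by (intro mult_right_mono norm_sum) auto
      then show "norm (A n) * real n powr (- \<sigma>) \<le> (\<Sum>k\<le>d. norm (coeff P k) * (norm (a k n) * real n powr (- \<sigma>)))"
        by (simp add: sum_distrib_right norm_mult mult.assoc)
    qed
    also have "\<dots> = (\<Sum>k\<le>d. norm (coeff P k) * (\<Sum>n=1..M. norm (a k n) * real n powr (- \<sigma>)))"
      by (subst sum.swap) (simp add: sum_distrib_left)
    also have "\<dots> \<le> (\<Sum>k\<le>d. norm (coeff P k) * (C * exp (- (b * real k) * \<sigma>)))"
    proof (intro sum_mono mult_left_mono)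
      fix k assume "k \<in> {..d}"
      then show "(\<Sum>n=1..M. norm (a k n) * real n powr (- \<sigma>)) \<le> C * exp (- (b * real k) * \<sigma>)"
        using a2[of k] ext[of k "\<lambda>n z. norm z * real n powr (- \<sigma>)"] by simp
    qed auto
    also have "\<dots> \<le> C * \<eta> / (1 - \<rho>)" by (rule geom)
    also have "\<dots> < e" using \<eta>e \<eta> e by linarith
    finally show "(\<Sum>n=1..M. norm (A n) * real n powr (- \<sigma>)) < e" .
    show "norm ((\<Sum>n=1..M. A n * of_nat n powr (- s)) - g s) < e" if s: "s \<in> K" for s
    proof -
      have "(\<Sum>n=1..M. A n * of_nat n powr (- s)) = (\<Sum>n=1..M. \<Sum>k\<le>d. coeff P k * (a k n * of_nat n powr (- s)))"
        by (simp add: A_def sum_distrib_right mult.assoc)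
      also have "\<dots> = (\<Sum>k\<le>d. coeff P k * (\<Sum>n=1..M. a k n * of_nat n powr (- s)))"
        by (subst sum.swap) (simp add: sum_distrib_left)
      also have "\<dots> = (\<Sum>k\<le>d. coeff P k * (\<Sum>n=1..N k. a k n * of_nat n powr (- s)))"
        using ext[of _ "\<lambda>n z. z * of_nat n powr (- s)"] by (intro sum.cong) auto
      finally have 1: "(\<Sum>n=1..M. A n * of_nat n powr (- s)) = (\<Sum>k\<le>d. coeff P k * (\<Sum>n=1..N k. a k n * of_nat n powr (- s)))" .
      have 2: "poly P (exp (- of_real b * s)) = (\<Sum>k\<le>d. coeff P k * exp (- of_real (b * real k) * s))"
        unfolding poly_altdef d_def by (intro sum.cong) (auto simp: exp_of_nat_mult[symmetric] mult_ac)
      have "norm ((\<Sum>n=1..M. A n * of_nat n powr (- s)) - poly P (exp (- of_real b * s)))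
        = norm (\<Sum>k\<le>d. coeff P k * ((\<Sum>n=1..N k. a k n * of_nat n powr (- s)) - exp (- of_real (b * real k) * s)))"
        unfolding 1 2 by (simp add: sum_subtractf right_diff_distrib)
      also have "\<dots> \<le> (\<Sum>k\<le>d. norm (coeff P k) * (C * exp (- (b * real k) * \<sigma>)))"
        by (rule sum_norm_le) (use a1[OF s] in \<open>auto simp: norm_mult intro!: mult_left_mono\<close>)
      also have "\<dots> \<le> C * \<eta> / (1 - \<rho>)" by (rule geom)
      finally have 3: "norm ((\<Sum>n=1..M. A n * of_nat n powr (- s)) - poly P (exp (- of_real b * s))) \<le> C * \<eta> / (1 - \<rho>)" .
      define u where "u = (\<Sum>n=1..M. A n * of_nat n powr (- s)) - poly P (exp (- of_real b * s))"
      define v where "v = poly P (exp (- of_real b * s)) - poly p s"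
      define w where "w = poly p s - g s"
      have "norm (u + v + w) \<le> norm u + norm v + norm w"
        using norm_triangle_ineq[of "u + v" w] norm_triangle_ineq[of u v] by linarith
      also have "\<dots> < e" using 3 P[OF s] p[OF s] \<eta>e e unfolding u_def v_def w_def by linarith
      finally show ?thesis by (simp add: u_def v_def w_def)
    qed
  qed
qed

theorem theorem3p1:
  fixes K :: "complex set" and f :: "nat \<Rightarrow> complex" and g :: "complex \<Rightarrow> complex"
    and \<sigma> \<epsilon> :: real
  assumes "compact K" and "K \<subseteq> {s. Re s \<le> 0}" and "connected (- K)"
    and "f \<in> Da_space" and "g \<in> A_space K" and "\<sigma> > 0" and "\<epsilon> > 0"
  shows "\<exists>(N::nat) (a :: nat \<Rightarrow> complex). (\<forall>n>N. a n = 0) \<and>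
           sup_norm_on K (\<lambda>s. (\<Sum>n=1..N. a n * (of_nat n :: complex) powr (- s)) - g s) < ennreal \<epsilon> \<and>
           dirichlet_norm \<sigma> (\<lambda>n. a n - f n) < ennreal \<epsilon>"
proof -
  define e where "e = \<epsilon> / 2"
  have e: "e > 0" using assms(7) by (simp add: e_def)
  define u where "u = (\<lambda>n. norm (f (Suc n)) * real (Suc n) powr (- \<sigma>))"
  have u0: "u n \<ge> 0" for n by (simp add: u_def)
  have "(\<Sum>n. ennreal (u n)) < \<infinity>"
    using assms(4,6) by (auto simp: Da_space_def dirichlet_norm_def u_def)
  then have su: "summable u" using u0 by (intro summable_suminf_not_top) (auto simp: less_top)
  obtain M where M: "(\<Sum>n. u (n + M)) < e"
  proof -
    have "\<exists>M. \<forall>n\<ge>M. norm (\<Sum>i. u (i + n)) < e" by (rule suminf_exist_split[OF e su])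
    then show ?thesis using that by (metis abs_less_iff order_refl real_norm_def)
  qed
  define f' where "f' = (\<lambda>n. if n \<le> M then f n else 0)"
  define F where "F = (\<lambda>s. \<Sum>n=1..M. f n * (of_nat n :: complex) powr (- s))"
  have holF: "F holomorphic_on UNIV" unfolding F_def by (intro holomorphic_intros) auto
  have g: "continuous_on K g" "g holomorphic_on interior K" using assms(5) by (auto simp: A_space_def)
  have g': "continuous_on K (\<lambda>s. g s - F s)" "(\<lambda>s. g s - F s) holomorphic_on interior K"
    using g holomorphic_on_subset[OF holF] holomorphic_on_imp_continuous_on
    by (auto intro!: continuous_on_diff holomorphic_on_diff)
  obtain N a where *: "\<forall>n>N. a n = 0"
    "\<forall>s\<in>K. norm ((\<Sum>n=1..N. a n * of_nat n powr (- s)) - (g s - F s)) < e"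
    and a_norm: "(\<Sum>n=1..N. norm (a n) * real n powr (- \<sigma>)) < e"
    using small_dirichlet_polynomial_approximation[OF assms(1-3) g' assms(6) e] by (elim exE conjE)
  have a: "\<And>n. n > N \<Longrightarrow> a n = 0" and a_close: "\<And>s. s \<in> K \<Longrightarrow> norm ((\<Sum>n=1..N. a n * of_nat n powr (- s)) - (g s - F s)) < e"
    using * by auto
  define h where "h = (\<lambda>n. a n + f' n)"
  define N' where "N' = N + M"
  have "\<forall>n>N'. h n = 0" using a by (simp add: h_def f'_def N'_def)
  moreover have "sup_norm_on K (\<lambda>s. (\<Sum>n=1..N'. h n * (of_nat n :: complex) powr (- s)) - g s) < ennreal \<epsilon>"
  proof -
    have "norm ((\<Sum>n=1..N'. h n * (of_nat n :: complex) powr (- s)) - g s) < e" if "s \<in> K" for s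
    proof -
      have "(\<Sum>n=1..N'. a n * (of_nat n :: complex) powr (- s)) = (\<Sum>n=1..N. a n * of_nat n powr (- s))"
        by (rule sum.mono_neutral_right) (use a in \<open>auto simp: N'_def\<close>)
      moreover have "(\<Sum>n=1..N'. f' n * (of_nat n :: complex) powr (- s)) = F s"
        unfolding F_def by (rule sum.mono_neutral_cong_right) (auto simp: N'_def f'_def)
      ultimately show ?thesis using a_close[OF that] by (simp add: h_def distrib_right sum.distrib algebra_simps)
    qed
    then have "sup_norm_on K (\<lambda>s. (\<Sum>n=1..N'. h n * (of_nat n :: complex) powr (- s)) - g s) \<le> ennreal e"
      unfolding sup_norm_on_def by (intro SUP_least ennreal_leI) (simp add: less_imp_le)
    also have "\<dots> < ennreal \<epsilon>" using assms(7) by (simp add: e_def ennreal_less_iff)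
    finally show ?thesis .
  qed
  moreover have "dirichlet_norm \<sigma> (\<lambda>n. h n - f n) < ennreal \<epsilon>"
  proof -
    define v where "v = (\<lambda>n. norm (a (Suc n)) * real (Suc n) powr (- \<sigma>))"
    define w where "w = (\<lambda>n. if n < M then 0 else u n)"
    have v: "v sums (\<Sum>n<N. v n)" by (rule sums_finite) (auto simp: v_def a)
    have "(\<Sum>n<N. v n) = (\<Sum>n=1..N. norm (a n) * real n powr (- \<sigma>))"
      unfolding v_def by (rule sum.reindex_bij_witness[of _ "\<lambda>n. n - 1" Suc]) auto
    then have vl: "(\<Sum>n<N. v n) < e" using a_norm by simp
    have "(\<lambda>n. w (n + M)) sums (\<Sum>n. u (n + M))"
      using summable_ignore_initial_segment[OF su, of M] by (simp add: w_def summable_sums)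
    then have "w sums ((\<Sum>n. u (n + M)) + (\<Sum>n<M. w n))" by (rule sums_iff_shift[THEN iffD1])
    then have w: "w sums (\<Sum>n. u (n + M))" by (simp add: w_def)
    have vw: "(\<lambda>n. v n + w n) sums ((\<Sum>n<N. v n) + (\<Sum>n. u (n + M)))" by (rule sums_add[OF v w])
    have "dirichlet_norm \<sigma> (\<lambda>n. h n - f n) \<le> (\<Sum>n. ennreal (v n + w n))"
      unfolding dirichlet_norm_def
    proof (intro suminf_le ennreal_leI)
      fix n
      have "norm (h (Suc n) - f (Suc n)) \<le> norm (a (Suc n)) + (if n < M then 0 else norm (f (Suc n)))"
        using norm_triangle_ineq4[of "a (Suc n)" "f (Suc n)"] by (simp add: h_def f'_def)
      then have "norm (h (Suc n) - f (Suc n)) * real (Suc n) powr (- \<sigma>) \<le>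
          (norm (a (Suc n)) + (if n < M then 0 else norm (f (Suc n)))) * real (Suc n) powr (- \<sigma>)"
        by (intro mult_right_mono) auto
      then show "norm (h (Suc n) - f (Suc n)) * real (Suc n) powr (- \<sigma>) \<le> v n + w n"
        by (auto simp: v_def w_def u_def distrib_right)
    qed auto
    also have "\<dots> = ennreal ((\<Sum>n<N. v n) + (\<Sum>n. u (n + M)))"
      by (rule suminf_ennreal_eq[OF _ vw]) (simp add: v_def w_def u_def)
    also have "\<dots> < ennreal \<epsilon>" by (rule ennreal_lessI) (use vl M assms(7) in \<open>auto simp: e_def\<close>)
    finally show ?thesis .
  qed
  ultimately show ?thesis by blast
qed

end
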